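(* Let $G$ be a second-countable locally compact Abelian group, and let $0\neq\mu=\sum_{x\in\Lambda}a(x)\,\delta_x$ be a positive definite, strongly almost periodic (hence also translation-bounded) measure on $G$. If $\Lambda$ is uniformly discrete, the following statements hold. (1) The set $B_\varepsilon=\{x\in\Lambda:\operatorname{Re}(a(x))\geq a(0)-\varepsilon\}$ is relatively dense for every $\varepsilon>0$. (2) The measure $\mu$ is sup-almost periodic. (3) The measure $\mu$ is norm-almost periodic. (4) There is a cut and project scheme $(G,H,\mathcal{L})$ and some $h\in C_0(H)$ such that $\mu=\omega_h$.
   Context: "Measure" means complex Radon measure; $a(x)=\mu(\{x\})$. $\mu$ is positive definite if $\mu(f*\widetilde f)\geq0$ for all $f\in C_{\mathsf c}(G)$, where $\widetilde f(x)=\overline{f(-x)}$. For compact $K\subseteq G$ set $\|\mu\|_K=\sup_{x\in G}|\mu|(x+K)$; $\mu$ is translation bounded if $\|\mu\|_K<\infty$ for every compact $K$. $\mu$ is strongly almost periodic if, for every $g\in C_{\mathsf c}(G)$, $\mu*g$ is a uniformly (Bohr) almost periodic function. $\Lambda\subseteq G$ is uniformly discrete if there is an open neighbourhood $U$ of $0$ with $(x+U)\cap(y+U)=\varnothing$ for distinct $x,y\in\Lambda$. Translations: $(T_tg)(x)=g(x-t)$ and $(T_t\mu)(g)=\mu(T_{-t}g)$. For translation-bounded pure point measures, $\|\omega\|_\infty=\sup_{x\in G}|\omega|(\{x\})$; $\mu$ is sup-almost periodic if $\{t\in G:\|\mu-T_t\mu\|_\infty<\varepsilon\}$ is relatively dense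 for every $\varepsilon>0$. $\mu$ is norm-almost periodic if, for a fixed compact $K\subseteq G$ with non-empty interior (the choice is irrelevant), $\{t\in G:\|\mu-T_t\mu\|_K<\varepsilon\}$ is relatively dense for every $\varepsilon>0$. A cut and project scheme $(G,H,\mathcal{L})$ consists of locally compact Abelian groups $G,H$ and a lattice (discrete co-compact subgroup) $\mathcal{L}\subseteq G\times H$ such that the projection $\pi_G$ is injective on $\mathcal{L}$ and $\pi_H(\mathcal{L})$ is dense in $H$. Put $L=\pi_G(\mathcal{L})$, and for $x\in L$ let $x^\star\in H$ be the unique element with $(x,x^\star)\in\mathcal{L}$. $\omega_h=\sum_{x\in L}h(x^\star)\,\delta_x$. $C_0(H)$ denotes continuous functions vanishing at infinity. *)

theory Defs
  imports "HOL-Analysis.Analysis" "HOL-Algebra.Coset"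
begin

section \<open>Functions on the ambient group\<close>

definition Cc :: "('g::topological_space \<Rightarrow> 'b::real_normed_vector) set" where
  "Cc = {f. continuous_on UNIV f \<and> compact (closure {x. f x \<noteq> 0})}"

definition translate :: "'g::ab_group_add \<Rightarrow> ('g \<Rightarrow> 'b) \<Rightarrow> 'g \<Rightarrow> 'b" where
  "translate t g = (\<lambda>x. g (x - t))"

definition reflect_cnj :: "('g::ab_group_add \<Rightarrow> complex) \<Rightarrow> 'g \<Rightarrow> complex" where
  "reflect_cnj f = (\<lambda>x. cnj (f (- x)))"

definition relatively_dense :: "'g::topological_ab_group_add set \<Rightarrow> bool" where
  "relatively_dense A \<longleftrightarrow> (\<exists>K. compact K \<and> {x + k |x k. x \<in> A \<and> k \<in> K} = UNIV)"

definition uniformly_discrete :: "'g::topological_ab_group_add set \<Rightarrow> bool" where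
  "uniformly_discrete A \<longleftrightarrow>
     (\<exists>U. open U \<and> 0 \<in> U \<and> (\<forall>x\<in>A. \<forall>y\<in>A. x \<noteq> y \<longrightarrow> (+) x ` U \<inter> (+) y ` U = {}))"

definition bohr_almost_periodic :: "('g::topological_ab_group_add \<Rightarrow> complex) \<Rightarrow> bool" where
  "bohr_almost_periodic f \<longleftrightarrow> continuous_on UNIV f \<and>
     (\<forall>\<epsilon>>0. relatively_dense {t. (SUP x. ennreal (norm (f x - translate t f x))) < ennreal \<epsilon>})"

text \<open>
  On a second-countable locally compact Hausdorff group every Borel measure that is finite on
  compact sets is regular, so regularity need not be part of the definition.
\<close>
definition haar_measure :: "'g::topological_ab_group_add measure \<Rightarrow> bool" where
  "haar_measure m \<longleftrightarrow> sets m = sets borel \<and> emeasure m UNIV \<noteq> 0 \<and>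
     (\<forall>K. compact K \<longrightarrow> emeasure m K < \<infinity>) \<and>
     (\<forall>t. \<forall>A\<in>sets borel. emeasure m ((+) t ` A) = emeasure m A)"

definition convolve ::
  "'g::topological_ab_group_add measure \<Rightarrow> ('g \<Rightarrow> complex) \<Rightarrow> ('g \<Rightarrow> complex) \<Rightarrow> 'g \<Rightarrow> complex" where
  "convolve m f g = (\<lambda>x. LINT y|m. f y * g (x - y))"


section \<open>Complex Radon measures\<close>

text \<open>
  A complex Radon measure is a linear functional on \<^const>\<open>Cc\<close> that is continuous in the inductive
  limit topology. Its values outside \<^const>\<open>Cc\<close> carry no information; in particular two measures
  are equal when they agree on \<^const>\<open>Cc\<close>.
\<close>
type_synonym 'g functional = "('g \<Rightarrow> complex) \<Rightarrow> complex"

definition radon_measure :: "'g::topological_space functional \<Rightarrow> bool" where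
  "radon_measure \<mu> \<longleftrightarrow>
     (\<forall>f\<in>Cc. \<forall>g\<in>Cc. \<mu> (\<lambda>x. f x + g x) = \<mu> f + \<mu> g) \<and>
     (\<forall>c. \<forall>f\<in>Cc. \<mu> (\<lambda>x. c * f x) = c * \<mu> f) \<and>
     (\<forall>K. compact K \<longrightarrow>
        (\<exists>C. \<forall>f\<in>Cc. (\<forall>x. x \<notin> K \<longrightarrow> f x = 0) \<longrightarrow> norm (\<mu> f) \<le> C * (SUP x. norm (f x))))"

text \<open>
  The value of \<open>\<mu>\<close> on the set \<open>{x}\<close>: by regularity, it is the limit of \<open>\<mu> f\<close> over test functions
  \<open>0 \<le> f \<le> 1\<close> with \<open>f x = 1\<close> whose supports shrink to \<open>x\<close>.
\<close>
definition point_mass :: "'g::topological_space functional \<Rightarrow> 'g \<Rightarrow> complex" where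
  "point_mass \<mu> x = (THE c. \<forall>\<epsilon>>0. \<exists>U. open U \<and> x \<in> U \<and>
     (\<forall>f::'g \<Rightarrow> real. f \<in> Cc \<longrightarrow> range f \<subseteq> {0..1} \<longrightarrow> f x = 1 \<longrightarrow> (\<forall>y. y \<notin> U \<longrightarrow> f y = 0) \<longrightarrow>
        norm (\<mu> (\<lambda>y. of_real (f y)) - c) < \<epsilon>))"

text \<open>
  \<open>\<mu> = (\<Sum>x\<in>S. c x \<cdot> \<delta>\<^sub>x)\<close>. Unconditional summability against every test function amounts to
  \<open>(\<Sum>x\<in>S \<inter> K. \<bar>c x\<bar>) < \<infinity>\<close> for every compact \<open>K\<close>.
\<close>
definition is_dirac_sum :: "'g::topological_space functional \<Rightarrow> 'g set \<Rightarrow> ('g \<Rightarrow> complex) \<Rightarrow> bool" where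
  "is_dirac_sum \<mu> S c \<longleftrightarrow> (\<forall>g\<in>Cc. ((\<lambda>x. c x * g x) has_sum \<mu> g) S)"

definition pure_point :: "'g::topological_space functional \<Rightarrow> bool" where
  "pure_point \<mu> \<longleftrightarrow> (\<exists>S c. is_dirac_sum \<mu> S c)"

text \<open>The total variation measure \<open>\<bar>\<mu>\<bar>\<close>, on nonnegative test functions and on compact sets.\<close>
definition variation_fun :: "'g::topological_space functional \<Rightarrow> ('g \<Rightarrow> real) \<Rightarrow> ennreal" where
  "variation_fun \<mu> f = (SUP g\<in>{g\<in>Cc. \<forall>x. norm (g x) \<le> f x}. ennreal (norm (\<mu> g)))"

definition variation_compact :: "'g::topological_space functional \<Rightarrow> 'g set \<Rightarrow> ennreal" where
  "variation_compact \<mu> K =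
     (INF f\<in>{f\<in>Cc. (\<forall>x. 0 \<le> f x) \<and> (\<forall>x\<in>K. 1 \<le> f x)}. variation_fun \<mu> f)"

definition norm_on :: "'g::topological_ab_group_add set \<Rightarrow> 'g functional \<Rightarrow> ennreal" where
  "norm_on K \<mu> = (SUP x. variation_compact \<mu> ((+) x ` K))"

definition translation_bounded :: "'g::topological_ab_group_add functional \<Rightarrow> bool" where
  "translation_bounded \<mu> \<longleftrightarrow> (\<forall>K. compact K \<longrightarrow> norm_on K \<mu> < \<infinity>)"

definition point_sup_norm :: "'g::topological_space functional \<Rightarrow> ennreal" where
  "point_sup_norm \<omega> = (SUP x. variation_compact \<omega> {x})"

definition translate_measure :: "'g::ab_group_add \<Rightarrow> 'g functional \<Rightarrow> 'g functional" where
  "translate_measure t \<mu> = (\<lambda>g. \<mu> (translate (- t) g))"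

definition positive_definite ::
  "'g::topological_ab_group_add measure \<Rightarrow> 'g functional \<Rightarrow> bool" where
  "positive_definite m \<mu> \<longleftrightarrow> (\<forall>f\<in>Cc. \<mu> (convolve m f (reflect_cnj f)) \<in> \<real>\<^sub>\<ge>\<^sub>0)"

definition convolve_measure :: "'g::ab_group_add functional \<Rightarrow> ('g \<Rightarrow> complex) \<Rightarrow> 'g \<Rightarrow> complex" where
  "convolve_measure \<mu> g = (\<lambda>x. \<mu> (\<lambda>y. g (x - y)))"

definition strongly_almost_periodic :: "'g::topological_ab_group_add functional \<Rightarrow> bool" where
  "strongly_almost_periodic \<mu> \<longleftrightarrow> (\<forall>g\<in>Cc. bohr_almost_periodic (convolve_measure \<mu> g))"

text \<open>The supremum norm is only considered on translation-bounded pure point measures.\<close>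
definition sup_almost_periodic :: "'g::topological_ab_group_add functional \<Rightarrow> bool" where
  "sup_almost_periodic \<mu> \<longleftrightarrow> translation_bounded \<mu> \<and> pure_point \<mu> \<and>
     (\<forall>\<epsilon>>0. relatively_dense
        {t. point_sup_norm (\<lambda>g. \<mu> g - translate_measure t \<mu> g) < ennreal \<epsilon>})"

text \<open>The property does not depend on the compact set \<open>K\<close> with non-empty interior.\<close>
definition norm_almost_periodic :: "'g::topological_ab_group_add functional \<Rightarrow> bool" where
  "norm_almost_periodic \<mu> \<longleftrightarrow>
     (\<forall>K. compact K \<and> interior K \<noteq> {} \<longrightarrow>
       (\<forall>\<epsilon>>0. relatively_dense
          {t. norm_on K (\<lambda>g. \<mu> g - translate_measure t \<mu> g) < ennreal \<epsilon>}))"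


section \<open>Cut and project schemes\<close>

text \<open>
  The internal group has to be existentially quantified, so locally compact Abelian groups are
  represented here by a group with explicit carrier together with a topology on that carrier.
\<close>
definition lca_group :: "'a monoid \<Rightarrow> 'a topology \<Rightarrow> bool" where
  "lca_group G T \<longleftrightarrow> comm_group G \<and> topspace T = carrier G \<and>
     continuous_map (prod_topology T T) T (\<lambda>(x, y). x \<otimes>\<^bsub>G\<^esub> y) \<and>
     continuous_map T T (\<lambda>x. inv\<^bsub>G\<^esub> x) \<and>
     Hausdorff_space T \<and> locally_compact_space T"

definition additive_group :: "'g::ab_group_add monoid" where
  "additive_group = \<lparr>carrier = UNIV, monoid.mult = (+), one = 0\<rparr>"

text \<open>
  Here \<open>Q\<close> is the quotient group \<open>G/L\<close> with its (uniquely determined) quotient topology.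
\<close>
definition cocompact_in :: "'a set \<Rightarrow> 'a monoid \<Rightarrow> 'a topology \<Rightarrow> bool" where
  "cocompact_in L G T \<longleftrightarrow>
     (\<exists>Q. topspace Q = rcosets\<^bsub>G\<^esub> L \<and> quotient_map T Q (\<lambda>x. L #>\<^bsub>G\<^esub> x) \<and> compact_space Q)"

definition lattice_in :: "'a set \<Rightarrow> 'a monoid \<Rightarrow> 'a topology \<Rightarrow> bool" where
  "lattice_in L G T \<longleftrightarrow>
     subgroup L G \<and> subtopology T L = discrete_topology L \<and> cocompact_in L G T"

definition cut_and_project_scheme ::
  "'a monoid \<Rightarrow> 'a topology \<Rightarrow> 'b monoid \<Rightarrow> 'b topology \<Rightarrow> ('a \<times> 'b) set \<Rightarrow> bool" where
  "cut_and_project_scheme G TG H TH \<L> \<longleftrightarrow> lca_group G TG \<and> lca_group H TH \<and>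
     lattice_in \<L> (G \<times>\<times> H) (prod_topology TG TH) \<and>
     inj_on fst \<L> \<and> TH closure_of (snd ` \<L>) = topspace TH"

definition star_map :: "('a \<times> 'b) set \<Rightarrow> 'a \<Rightarrow> 'b" where
  "star_map \<L> x = (THE y. (x, y) \<in> \<L>)"

definition C0 :: "'b topology \<Rightarrow> ('b \<Rightarrow> complex) set" where
  "C0 T = {h. continuous_map T euclidean h \<and>
     (\<forall>\<epsilon>>0. \<exists>K. compactin T K \<and> (\<forall>x\<in>topspace T - K. norm (h x) < \<epsilon>))}"

text \<open>\<open>\<mu> = \<omega>\<^sub>h\<close>\<close>
definition is_model_comb ::
  "'a::topological_space functional \<Rightarrow> ('a \<times> 'b) set \<Rightarrow> ('b \<Rightarrow> complex) \<Rightarrow> bool" where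
  "is_model_comb \<mu> \<L> h \<longleftrightarrow> is_dirac_sum \<mu> (fst ` \<L>) (\<lambda>x. h (star_map \<L> x))"

end

theory Submission
  imports Defs
begin

text \<open>
  Testing positive definiteness on \<open>f = \<Sum>\<^sub>i c\<^sub>i \<phi>(\<cdot> - p\<^sub>i)\<close> with \<open>\<phi>\<close> supported near \<open>0\<close> isolates the
  points \<open>p\<^sub>i - p\<^sub>j\<close> of the discrete set \<open>\<Lambda>\<close>, so \<open>a\<close> is a positive definite function and Krein's
  inequality \<open>\<bar>a(x + t) - a(x)\<bar>\<^sup>2 \<le> 2 a(0) (a(0) - Re a(t))\<close> holds. An almost period \<open>t\<close> of \<open>\<mu> * g\<close>,
  with \<open>g\<close> a bump function of small support, lies close to some \<open>y \<in> \<Lambda>\<close> with \<open>Re a(y)\<close> almost \<open>a(0)\<close>,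
  and by Krein's inequality such \<open>y\<close> are almost periods of \<open>a\<close> in the supremum norm. As \<open>\<Lambda>\<close> has
  boundedly many points in each translate of a compact set, these are also almost periods for the
  norm \<open>\<parallel>\<cdot>\<parallel>\<^sub>K\<close>.

  The internal group \<open>H\<close> is the closure of the orbit of \<open>a\<close> under all translations, in the supremum
  norm; addition of translation parameters extends to it by continuity. Here \<open>L\<close> is all of \<open>G\<close>, the
  star map sends \<open>t\<close> to \<open>a(\<cdot> + t)\<close>, and \<open>h\<close> is evaluation at \<open>0\<close>. The set \<open>{t. \<epsilon> \<le> \<bar>a(t)\<bar>}\<close> is totally
  bounded in the supremum metric because it is covered by finitely many translates of almost
  periods; this makes \<open>H\<close> locally compact and \<open>h\<close> vanish at infinity.
\<close>

section \<open>Relatively dense sets\<close>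

text \<open>From \<open>A + K = UNIV\<close> follows \<open>B + (W + K) = UNIV\<close>, and
  \<open>W + K\<close> is compact as a continuous image of \<open>W \<times> K\<close>.\<close>

lemma relatively_dense_cover:
  fixes A B :: "'g::topological_ab_group_add set"
  assumes "relatively_dense A" "compact W" "\<And>x. x \<in> A \<Longrightarrow> \<exists>b\<in>B. x - b \<in> W"
  shows "relatively_dense B"
proof -
  obtain K where K: "compact K" "{x + k |x k. x \<in> A \<and> k \<in> K} = UNIV"
    using assms(1) unfolding relatively_dense_def by blast
  have "compact ((\<lambda>p. fst p + snd p) ` (W \<times> K))"
    using K(1) assms(2) by (intro compact_continuous_image compact_Times continuous_intros)
  moreover have "\<exists>b k. g = b + k \<and> b \<in> B \<and> k \<in> (\<lambda>p. fst p + snd p) ` (W \<times> K)" for g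
  proof -
    obtain x k where xk: "x \<in> A" "k \<in> K" "g = x + k" using UNIV_I[of g] unfolding K(2)[symmetric] by auto
    obtain b where b: "b \<in> B" "x - b \<in> W" using assms(3)[OF xk(1)] by blast
    have "x - b + k \<in> (\<lambda>p. fst p + snd p) ` (W \<times> K)"
      using b xk by (intro image_eqI[of _ _ "(x - b, k)"]) auto
    then show ?thesis using b xk(3) by (intro exI[of _ b] exI[of _ "x - b + k"]) simp
  qed
  ultimately show ?thesis unfolding relatively_dense_def by blast
qed

lemma relatively_dense_mono:
  fixes A B :: "'g::topological_ab_group_add set"
  assumes "relatively_dense A" "A \<subseteq> B"
  shows "relatively_dense B"
  using assms(1) by (rule relatively_dense_cover[of _ "{0}"]) (use assms(2) in force)+

section \<open>Test functions\<close>

lemma CcI: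
  fixes f :: "'g::t2_space \<Rightarrow> 'b::real_normed_vector"
  assumes "continuous_on UNIV f" "compact K" "\<And>x. f x \<noteq> 0 \<Longrightarrow> x \<in> K"
  shows "f \<in> Cc"
proof -
  have "closure {x. f x \<noteq> 0} \<subseteq> K"
    using assms by (intro closure_minimal compact_imp_closed) auto
  then have "compact (closure {x. f x \<noteq> 0})"
    using assms(2) by (metis closed_Int_compact closed_closure inf.absorb_iff1)
  with assms(1) show ?thesis by (simp add: Cc_def)
qed

lemma Cc_continuous: "f \<in> Cc \<Longrightarrow> continuous_on UNIV f"
  by (simp add: Cc_def)

lemma Cc_support:
  assumes "f \<in> Cc"
  obtains K where "compact K" "\<And>x. f x \<noteq> 0 \<Longrightarrow> x \<in> K"
  using assms closure_subset[of "{x. f x \<noteq> 0}"] unfolding Cc_def by blast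

lemma Cc_of_real:
  fixes f :: "'g::t2_space \<Rightarrow> real"
  assumes "f \<in> Cc"
  shows "(\<lambda>x. of_real (f x) :: complex) \<in> Cc"
proof -
  obtain K where "compact K" "\<And>x. f x \<noteq> 0 \<Longrightarrow> x \<in> K" using Cc_support[OF assms] by blast
  then show ?thesis
    using Cc_continuous[OF assms] by (intro CcI[of _ K] continuous_intros) auto
qed

lemma Cc_cmult:
  fixes f :: "'g::t2_space \<Rightarrow> 'b::real_normed_algebra"
  assumes "f \<in> Cc"
  shows "(\<lambda>x. c * f x) \<in> Cc"
proof -
  obtain K where K: "compact K" "\<And>x. f x \<noteq> 0 \<Longrightarrow> x \<in> K" using Cc_support[OF assms] by blast
  have "x \<in> K" if "c * f x \<noteq> 0" for x using K(2)[of x] that by (cases "f x = 0") auto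
  then show ?thesis
    using Cc_continuous[OF assms] K(1) by (intro CcI[of _ K] continuous_intros) auto
qed

lemma Cc_add:
  fixes f g :: "'g::t2_space \<Rightarrow> 'b::real_normed_vector"
  assumes "f \<in> Cc" "g \<in> Cc"
  shows "(\<lambda>x. f x + g x) \<in> Cc"
proof -
  obtain K where K: "compact K" "\<And>x. f x \<noteq> 0 \<Longrightarrow> x \<in> K" using Cc_support[OF assms(1)] by blast
  obtain L where L: "compact L" "\<And>x. g x \<noteq> 0 \<Longrightarrow> x \<in> L" using Cc_support[OF assms(2)] by blast
  have "x \<in> K \<union> L" if "f x + g x \<noteq> 0" for x using that K(2)[of x] L(2)[of x] by (cases "f x = 0") auto
  then show ?thesis
    using Cc_continuous[OF assms(1)] Cc_continuous[OF assms(2)] K L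
    by (intro CcI[of _ "K \<union> L"] continuous_intros compact_Un) auto
qed

lemma Cc_zero: "(\<lambda>x. 0 :: 'b::real_normed_vector) \<in> (Cc :: ('g::t2_space \<Rightarrow> 'b) set)"
  by (rule CcI[of _ "{}"]) auto

lemma Cc_sum:
  fixes f :: "'i \<Rightarrow> 'g::t2_space \<Rightarrow> 'b::real_normed_vector"
  assumes "\<And>i. i \<in> I \<Longrightarrow> f i \<in> Cc"
  shows "(\<lambda>x. \<Sum>i\<in>I. f i x) \<in> Cc"
  using assms by (induction I rule: infinite_finite_induct) (auto simp: Cc_zero Cc_add)

lemma compact_shift:
  fixes K :: "'g::topological_ab_group_add set"
  assumes "compact K"
  shows "compact {x. x - t \<in> K}"
proof -
  have "{x. x - t \<in> K} = (\<lambda>x. x + t) ` K" by (force simp: image_iff intro: bexI[of _ "x - t" for x])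
  then show ?thesis
    using assms by (auto intro!: compact_continuous_image continuous_intros)
qed

lemma Cc_shift:
  fixes f :: "'g::{topological_ab_group_add, t2_space} \<Rightarrow> 'b::real_normed_vector"
  assumes "f \<in> Cc"
  shows "(\<lambda>x. f (x - t)) \<in> Cc"
proof -
  obtain K where K: "compact K" "\<And>x. f x \<noteq> 0 \<Longrightarrow> x \<in> K" using Cc_support[OF assms] by blast
  have "continuous_on UNIV (\<lambda>x. f (x - t))"
    by (rule continuous_on_compose2[OF Cc_continuous[OF assms]]) (auto intro!: continuous_intros)
  then show ?thesis
    using K by (intro CcI[of _ "{x. x - t \<in> K}"] compact_shift) auto
qed

lemma Cc_reflect:
  fixes f :: "'g::{topological_ab_group_add, t2_space} \<Rightarrow> 'b::real_normed_vector"
  assumes "f \<in> Cc"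
  shows "(\<lambda>x. f (t - x)) \<in> Cc"
proof -
  obtain K where K: "compact K" "\<And>x. f x \<noteq> 0 \<Longrightarrow> x \<in> K" using Cc_support[OF assms] by blast
  have "continuous_on UNIV (\<lambda>x. f (t - x))"
    by (rule continuous_on_compose2[OF Cc_continuous[OF assms]]) (auto intro!: continuous_intros)
  moreover have "compact ((\<lambda>x. t - x) ` K)"
    using K by (intro compact_continuous_image continuous_intros) auto
  ultimately show ?thesis
    using K by (intro CcI[of _ "(\<lambda>x. t - x) ` K"]) (auto simp: image_iff intro!: bexI[of _ "t - x" for x])
qed

text \<open>A locally compact Hausdorff space is completely regular, so \<open>z\<close> can be
  separated from the complement of \<open>U \<inter> V\<close>, where \<open>U\<close> lies inside a
  compact set and thereby makes the support compact.\<close>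

lemma bump_exists:
  fixes z :: "'g::t2_space"
  assumes lc: "locally_compact_space (euclidean :: 'g topology)" and V: "open V" "z \<in> V"
  obtains \<phi> :: "'g \<Rightarrow> real"
  where "\<phi> \<in> Cc" "range \<phi> \<subseteq> {0..1}" "\<phi> z = 1" "\<And>y. y \<notin> V \<Longrightarrow> \<phi> y = 0"
proof -
  obtain U K where UK: "open U" "compact K" "z \<in> U" "U \<subseteq> K"
    using lc[unfolded locally_compact_space_def, THEN bspec[where x = z]]
    by (auto simp: open_openin[symmetric])
  have "Hausdorff_space (euclidean :: 'g topology)"
    using hausdorff by (auto simp: Hausdorff_space_def disjnt_def)
  then have "completely_regular_space (euclidean :: 'g topology)"
    using lc by (intro locally_compact_regular_imp_completely_regular_space) auto
  moreover have "closedin euclidean (- (U \<inter> V))" "z \<in> topspace euclidean - (- (U \<inter> V))"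
    using UK V by (auto simp: closed_closedin[symmetric] open_Int)
  ultimately obtain f :: "'g \<Rightarrow> real" where f: "continuous_map euclidean (top_of_set {0..1}) f"
      "f z = 0" "f ` (- (U \<inter> V)) \<subseteq> {1}"
    unfolding completely_regular_space_def by blast
  have cont: "continuous_on UNIV f" and rng: "range f \<subseteq> {0..1}"
    using f(1) by (auto simp: continuous_map_in_subtopology)
  show thesis
  proof
    show "(\<lambda>x. 1 - f x) \<in> Cc"
      using cont f(3) UK by (intro CcI[of _ K] continuous_intros) auto
    show "range (\<lambda>x. 1 - f x) \<subseteq> {0..1}" "1 - f z = 1" "\<And>y. y \<notin> V \<Longrightarrow> 1 - f y = 0"
      using rng f by (auto simp: image_subset_iff)
  qed
qed

text \<open>Continuity of subtraction at \<open>(0, 0)\<close>.\<close>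

lemma difference_neighbourhood:
  fixes V :: "'g::topological_ab_group_add set"
  assumes "open V" "0 \<in> V"
  obtains W where "open W" "0 \<in> W" "\<And>v w. v \<in> W \<Longrightarrow> w \<in> W \<Longrightarrow> v - w \<in> V"
proof -
  have "open ((\<lambda>p :: 'g \<times> 'g. fst p - snd p) -` V)"
    using assms(1) by (intro open_vimage continuous_intros)
  moreover have "(0, 0) \<in> (\<lambda>p :: 'g \<times> 'g. fst p - snd p) -` V" using assms(2) by simp
  ultimately obtain A B where AB: "open A" "open B" "(0, 0) \<in> A \<times> B"
      "A \<times> B \<subseteq> (\<lambda>p :: 'g \<times> 'g. fst p - snd p) -` V"
    by (rule open_prod_elim)
  then show thesis by (intro that[of "A \<inter> B"]) auto
qed

lemma open_shift:
  fixes U :: "'g::topological_ab_group_add set"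
  shows "open U \<Longrightarrow> open {y. y - k \<in> U}"
  using open_vimage[of U "\<lambda>y. y - k"] by (simp add: vimage_def continuous_intros)

text \<open>Finitely many of the sets where a translated bump exceeds 1/2 cover \<open>K\<close>,
  and there the sum of the doubled bumps is at least 1. Such an \<open>f\<close> is a competitor in
  the infimum that defines \<open>variation_compact\<close>.\<close>

lemma cutoff_exists:
  fixes K :: "'g::{topological_ab_group_add, t2_space} set"
  assumes lc: "locally_compact_space (euclidean :: 'g topology)" and K: "compact K"
  obtains f :: "'g \<Rightarrow> real" and B where "f \<in> Cc" "\<And>x. 0 \<le> f x" "\<And>x. f x \<le> B" "\<And>x. x \<in> K \<Longrightarrow> 1 \<le> f x"
proof -
  obtain \<phi> :: "'g \<Rightarrow> real" where \<phi>: "\<phi> \<in> Cc" "range \<phi> \<subseteq> {0..1}" "\<phi> 0 = 1"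
    using bump_exists[OF lc, of UNIV 0] by auto
  have r: "0 \<le> \<phi> x" "\<phi> x \<le> 1" for x using \<phi>(2) by (auto simp: image_subset_iff)
  let ?U = "\<lambda>k. {y. y - k \<in> \<phi> -` {1/2<..}}"
  have "open (\<phi> -` {1/2<..})" using Cc_continuous[OF \<phi>(1)] by (intro open_vimage) auto
  then have "\<forall>k\<in>K. open (?U k)" using open_shift by blast
  moreover have "K \<subseteq> (\<Union>k\<in>K. ?U k)" using \<phi>(3) by auto
  ultimately obtain D where D: "D \<subseteq> K" "finite D" "K \<subseteq> (\<Union>k\<in>D. ?U k)"
    using compactE_image[OF K, of K ?U] by blast
  show thesis
  proof
    show "(\<lambda>x. \<Sum>k\<in>D. 2 * \<phi> (x - k)) \<in> Cc" by (intro Cc_sum Cc_cmult Cc_shift \<phi>)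
    show "0 \<le> (\<Sum>k\<in>D. 2 * \<phi> (x - k))" for x using r by (intro sum_nonneg) auto
    show "(\<Sum>k\<in>D. 2 * \<phi> (x - k)) \<le> (\<Sum>k\<in>D. 2 * 1)" for x
      using r by (intro sum_mono) auto
    fix x assume "x \<in> K"
    then obtain k where "k \<in> D" "1/2 < \<phi> (x - k)" using D(3) by auto
    moreover have "2 * \<phi> (x - k) \<le> (\<Sum>k\<in>D. 2 * \<phi> (x - k))"
      using \<open>k \<in> D\<close> D(2) r by (intro member_le_sum) auto
    ultimately show "1 \<le> (\<Sum>k\<in>D. 2 * \<phi> (x - k))" by linarith
  qed
qed

section \<open>Dirac combs on uniformly discrete sets\<close>

text \<open>If \<open>p - z\<close> and \<open>q - z\<close> lie in \<open>U\<close>, then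
  \<open>p + (q - z) = q + (p - z)\<close> is a common point of \<open>p + U\<close> and
  \<open>q + U\<close>.\<close>

lemma uniformly_discreteE:
  assumes "uniformly_discrete \<Lambda>"
  obtains U where "open U" "0 \<in> U"
    "\<And>p q z. p \<in> \<Lambda> \<Longrightarrow> q \<in> \<Lambda> \<Longrightarrow> p - z \<in> U \<Longrightarrow> q - z \<in> U \<Longrightarrow> p = q"
proof -
  obtain U where U: "open U" "0 \<in> U"
      "\<And>x y. x \<in> \<Lambda> \<Longrightarrow> y \<in> \<Lambda> \<Longrightarrow> x \<noteq> y \<Longrightarrow> (+) x ` U \<inter> (+) y ` U = {}"
    using assms unfolding uniformly_discrete_def by blast
  have "p = q" if "p \<in> \<Lambda>" "q \<in> \<Lambda>" "p - z \<in> U" "q - z \<in> U" for p q z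
  proof (rule ccontr)
    assume "p \<noteq> q"
    moreover have "p + (q - z) \<in> (+) p ` U" "q + (p - z) \<in> (+) q ` U" using that by auto
    moreover have "p + (q - z) = q + (p - z)" by (simp add: algebra_simps)
    ultimately show False using U(3)[OF that(1,2)] by auto
  qed
  with U(1,2) show thesis by (rule that)
qed

text \<open>At most one point of \<open>\<Lambda>\<close> lies in \<open>z + U\<close>; if it
  differs from \<open>z\<close> it is removed, since points are closed. The centre \<open>z\<close>
  may lie outside \<open>\<Lambda>\<close>.\<close>

lemma uniformly_discrete_isolated:
  fixes \<Lambda> :: "'g::{topological_ab_group_add, t2_space} set"
  assumes "uniformly_discrete \<Lambda>"
  obtains V where "open V" "z \<in> V" "\<And>y. y \<in> \<Lambda> \<Longrightarrow> y \<in> V \<Longrightarrow> y = z"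
proof -
  obtain U where U: "open U" "0 \<in> U"
    "\<And>p q z. p \<in> \<Lambda> \<Longrightarrow> q \<in> \<Lambda> \<Longrightarrow> p - z \<in> U \<Longrightarrow> q - z \<in> U \<Longrightarrow> p = q"
    by (rule uniformly_discreteE[OF assms]) blast
  let ?V = "{y. y - z \<in> U}"
  show thesis
  proof (cases "\<exists>p\<in>\<Lambda>. p \<in> ?V \<and> p \<noteq> z")
    case True
    then obtain p where p: "p \<in> \<Lambda>" "p \<in> ?V" "p \<noteq> z" by blast
    show thesis
      by (rule that[of "?V - {p}"])
        (use U p open_shift[OF U(1)] in \<open>auto intro!: open_Diff\<close>)
  qed (use U open_shift[OF U(1)] in \<open>intro that[of ?V], auto\<close>)
qed

text \<open>Finiteness is demanded separately because \<open>card\<close> of an infinite set is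
  0.\<close>

definition has_density :: "'g::ab_group_add set \<Rightarrow> 'g set \<Rightarrow> nat \<Rightarrow> bool" where
  "has_density \<Gamma> Z N \<longleftrightarrow> (\<forall>x. finite {y \<in> \<Gamma>. y - x \<in> Z} \<and> card {y \<in> \<Gamma>. y - x \<in> Z} \<le> N)"

text \<open>Finitely many translates of \<open>U\<close> cover \<open>K\<close>, and each of them,
  shifted by \<open>x\<close>, holds at most one point of \<open>\<Lambda>\<close>. Their number is
  a bound independent of \<open>x\<close>.\<close>

lemma uniformly_discrete_has_density:
  fixes \<Lambda> :: "'g::{topological_ab_group_add, t2_space} set"
  assumes "uniformly_discrete \<Lambda>" "compact K"
  obtains N where "has_density \<Lambda> K N"
proof -
  obtain U where U: "open U" "0 \<in> U"
    "\<And>p q z. p \<in> \<Lambda> \<Longrightarrow> q \<in> \<Lambda> \<Longrightarrow> p - z \<in> U \<Longrightarrow> q - z \<in> U \<Longrightarrow> p = q"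
    by (rule uniformly_discreteE[OF assms(1)]) blast
  have "\<forall>k\<in>K. open {y. y - k \<in> U}" "K \<subseteq> (\<Union>k\<in>K. {y. y - k \<in> U})"
    using open_shift[OF U(1)] U(2) by auto
  then obtain D where D: "D \<subseteq> K" "finite D" "K \<subseteq> (\<Union>k\<in>D. {y. y - k \<in> U})"
    using compactE_image[OF assms(2), of K "\<lambda>k. {y. y - k \<in> U}"] by blast
  have "finite {y \<in> \<Lambda>. y - x \<in> K} \<and> card {y \<in> \<Lambda>. y - x \<in> K} \<le> card D" for x
  proof -
    have "\<forall>y\<in>{y \<in> \<Lambda>. y - x \<in> K}. \<exists>k\<in>D. y - (x + k) \<in> U"
    proof
      fix y assume "y \<in> {y \<in> \<Lambda>. y - x \<in> K}"
      then have "y - x \<in> (\<Union>k\<in>D. {y. y - k \<in> U})" using D(3) by blast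
      then show "\<exists>k\<in>D. y - (x + k) \<in> U" by (simp add: diff_diff_eq)
    qed
    then obtain c where c: "\<And>y. y \<in> {y \<in> \<Lambda>. y - x \<in> K} \<Longrightarrow> c y \<in> D \<and> y - (x + c y) \<in> U" by metis
    have "inj_on c {y \<in> \<Lambda>. y - x \<in> K}"
    proof (rule inj_onI)
      fix y y' assume y: "y \<in> {y \<in> \<Lambda>. y - x \<in> K}" "y' \<in> {y \<in> \<Lambda>. y - x \<in> K}" "c y = c y'"
      show "y = y'" by (rule U(3)[of _ _ "x + c y"]) (use c[OF y(1)] c[OF y(2)] y in auto)
    qed
    moreover have "c ` {y \<in> \<Lambda>. y - x \<in> K} \<subseteq> D" using c by auto
    ultimately show ?thesis using D(2) by (meson card_inj_on_le inj_on_finite)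
  qed
  then have "has_density \<Lambda> K (card D)" by (simp add: has_density_def)
  then show thesis by (rule that)
qed

text \<open>A small neighbourhood of \<open>z\<close> misses \<open>\<Lambda>\<close>, so
  \<open>\<mu>\<close> vanishes on test functions supported there. This makes \<open>a\<close> a
  function on the whole group that is zero off \<open>\<Lambda>\<close>.\<close>

lemma point_mass_off:
  fixes \<Lambda> :: "'g::{topological_ab_group_add, t2_space} set"
  assumes lc: "locally_compact_space (euclidean :: 'g topology)"
    and sum: "is_dirac_sum \<mu> \<Lambda> a" and "uniformly_discrete \<Lambda>" "z \<notin> \<Lambda>"
  shows "point_mass \<mu> z = 0"
  unfolding point_mass_def
proof (rule the_equality)
  obtain V where V: "open V" "z \<in> V" "\<And>y. y \<in> \<Lambda> \<Longrightarrow> y \<in> V \<Longrightarrow> y = z"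
    by (rule uniformly_discrete_isolated[OF assms(3)]) blast
  have 0: "\<mu> (\<lambda>y. of_real (f y)) = 0" if "f \<in> Cc" "\<forall>y. y \<notin> V \<longrightarrow> f y = 0" for f :: "'g \<Rightarrow> real"
  proof -
    have "a x * of_real (f x) = 0" if "x \<in> \<Lambda>" for x
      using V(3)[OF that] assms(4) that \<open>\<forall>y. y \<notin> V \<longrightarrow> f y = 0\<close> by (cases "x \<in> V") auto
    then have "((\<lambda>x. a x * of_real (f x)) has_sum 0) \<Lambda>" by (simp add: has_sum_0)
    moreover have "((\<lambda>x. a x * of_real (f x)) has_sum \<mu> (\<lambda>y. of_real (f y))) \<Lambda>"
      using bspec[OF sum[unfolded is_dirac_sum_def] Cc_of_real[OF that(1)]] .
    ultimately show ?thesis by (rule has_sum_unique[symmetric])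
  qed
  show "\<forall>\<epsilon>>0. \<exists>U. open U \<and> z \<in> U \<and> (\<forall>f::'g \<Rightarrow> real. f \<in> Cc \<longrightarrow> range f \<subseteq> {0..1} \<longrightarrow> f z = 1 \<longrightarrow>
      (\<forall>y. y \<notin> U \<longrightarrow> f y = 0) \<longrightarrow> norm (\<mu> (\<lambda>y. of_real (f y)) - 0) < \<epsilon>)"
    using V(1,2) 0 by auto
  fix c
  assume c: "\<forall>\<epsilon>>0. \<exists>U. open U \<and> z \<in> U \<and> (\<forall>f::'g \<Rightarrow> real. f \<in> Cc \<longrightarrow> range f \<subseteq> {0..1} \<longrightarrow> f z = 1 \<longrightarrow>
      (\<forall>y. y \<notin> U \<longrightarrow> f y = 0) \<longrightarrow> norm (\<mu> (\<lambda>y. of_real (f y)) - c) < \<epsilon>)"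
  have "norm c < e" if "0 < e" for e
  proof -
    obtain U where U: "open U" "z \<in> U" "\<And>f::'g \<Rightarrow> real. f \<in> Cc \<Longrightarrow> range f \<subseteq> {0..1} \<Longrightarrow> f z = 1 \<Longrightarrow>
      (\<forall>y. y \<notin> U \<longrightarrow> f y = 0) \<Longrightarrow> norm (\<mu> (\<lambda>y. of_real (f y)) - c) < e"
      using c \<open>0 < e\<close> by blast
    \<comment> \<open>Uniqueness of the limit needs an actual test function supported in both
      neighbourhoods; otherwise the condition on \<open>c\<close> could hold vacuously.\<close>
    obtain \<phi> :: "'g \<Rightarrow> real" where "\<phi> \<in> Cc" "range \<phi> \<subseteq> {0..1}" "\<phi> z = 1" "\<And>y. y \<notin> U \<inter> V \<Longrightarrow> \<phi> y = 0"
      by (rule bump_exists[OF lc, of "U \<inter> V" z]) (use U(1,2) V(1,2) in auto)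
    then show ?thesis using U(3)[of \<phi>] 0[of \<phi>] by auto
  qed
  then show "c = 0" by (metis less_irrefl zero_less_norm_iff)
qed

section \<open>Evaluation of discrete combs and the supremum norm of their differences\<close>

text \<open>The weight \<open>a\<close> is defined on the whole group, so that
  \<open>a (y - t)\<close> makes sense at arbitrary points.\<close>

locale discrete_comb =
  fixes \<mu> :: "'g::{topological_ab_group_add, t2_space} functional"
    and \<Lambda> :: "'g set" and a :: "'g \<Rightarrow> complex"
  assumes lc: "locally_compact_space (euclidean :: 'g topology)"
    and dirac_sum: "is_dirac_sum \<mu> \<Lambda> a"
    and discrete: "uniformly_discrete \<Lambda>"
    and off: "x \<notin> \<Lambda> \<Longrightarrow> a x = 0"
begin

text \<open>Only finitely many terms of the series survive. The set \<open>F\<close> may contain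
  points outside \<open>\<Lambda>\<close>, where \<open>a\<close> vanishes, so that a single
  \<open>F\<close> can serve \<open>\<mu>\<close> and its translate.\<close>

lemma eval:
  assumes "g \<in> Cc" "finite F" "\<And>y. y \<in> \<Lambda> \<Longrightarrow> a y \<noteq> 0 \<Longrightarrow> g y \<noteq> 0 \<Longrightarrow> y \<in> F"
  shows "\<mu> g = (\<Sum>y\<in>F. a y * g y)"
proof -
  have "((\<lambda>y. a y * g y) has_sum \<mu> g) \<Lambda>" using dirac_sum assms(1) by (simp add: is_dirac_sum_def)
  then have "((\<lambda>y. a y * g y) has_sum \<mu> g) F"
    by (rule has_sum_cong_neutral[THEN iffD1, rotated -1]) (use assms(3) off in auto)
  moreover have "((\<lambda>y. a y * g y) has_sum (\<Sum>y\<in>F. a y * g y)) F"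
    using assms(2) by (rule has_sum_finite)
  ultimately show ?thesis by (rule has_sum_unique)
qed

lemma eval_translate:
  assumes "g \<in> Cc" "finite F" "\<And>y. y - t \<in> \<Lambda> \<Longrightarrow> g y \<noteq> 0 \<Longrightarrow> y \<in> F"
  shows "translate_measure t \<mu> g = (\<Sum>y\<in>F. a (y - t) * g y)"
proof -
  have "translate_measure t \<mu> g = (\<Sum>y\<in>(\<lambda>y. y - t) ` F. a y * g (y - - t))"
    unfolding translate_measure_def translate_def
  proof (rule eval)
    fix y assume "y \<in> \<Lambda>" "g (y - - t) \<noteq> 0"
    then have "y + t \<in> F" using assms(3)[of "y + t"] by simp
    then show "y \<in> (\<lambda>y. y - t) ` F" by (auto simp: image_iff intro: bexI[of _ "y + t"])
  qed (use assms Cc_shift[OF assms(1), of "- t"] in auto)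
  also have "\<dots> = (\<Sum>y\<in>F. a (y - t) * g y)"
    by (subst sum.reindex) (auto simp: inj_on_def)
  finally show ?thesis .
qed

text \<open>The difference is the comb with weights \<open>a y - a (y - t)\<close>, carried by
  \<open>\<Lambda>\<close> and its translate by \<open>t\<close>; hence \<open>F\<close> has to
  catch both.\<close>

lemma norm_diff_translate_le:
  assumes "g \<in> Cc" "finite F" "\<And>y. y \<in> \<Lambda> \<union> {y. y - t \<in> \<Lambda>} \<Longrightarrow> g y \<noteq> 0 \<Longrightarrow> y \<in> F"
    and "\<And>y. norm (a y - a (y - t)) \<le> \<delta>"
  shows "norm (\<mu> g - translate_measure t \<mu> g) \<le> \<delta> * (\<Sum>y\<in>F. norm (g y))"
proof -
  have "\<mu> g - translate_measure t \<mu> g = (\<Sum>y\<in>F. (a y - a (y - t)) * g y)"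
    using assms(3) by (simp add: eval[OF assms(1,2)] eval_translate[OF assms(1,2)]
        sum_subtractf[symmetric] left_diff_distrib)
  also have "norm \<dots> \<le> (\<Sum>y\<in>F. norm ((a y - a (y - t)) * g y))" by (rule norm_sum)
  also have "\<dots> \<le> (\<Sum>y\<in>F. \<delta> * norm (g y))"
    using assms(4) by (intro sum_mono) (auto simp: norm_mult intro!: mult_right_mono)
  finally show ?thesis by (simp add: sum_distrib_left)
qed

text \<open>Points of \<open>\<Lambda>\<close> and of \<open>\<Lambda> + t\<close> may come
  arbitrarily close to each other, so the neighbourhood is chosen for each \<open>z\<close>
  separately.\<close>

lemma isolated_pair:
  obtains V where "open V" "z \<in> V" "\<And>y. y \<in> \<Lambda> \<union> {y. y - t \<in> \<Lambda>} \<Longrightarrow> y \<in> V \<Longrightarrow> y = z"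
proof -
  obtain V where V: "open V" "z \<in> V" "\<And>y. y \<in> \<Lambda> \<Longrightarrow> y \<in> V \<Longrightarrow> y = z"
    by (rule uniformly_discrete_isolated[OF discrete]) blast
  obtain W where W: "open W" "z - t \<in> W" "\<And>y. y \<in> \<Lambda> \<Longrightarrow> y \<in> W \<Longrightarrow> y = z - t"
    by (rule uniformly_discrete_isolated[OF discrete]) blast
  have "y = z" if "y - t \<in> \<Lambda>" "y - t \<in> W" for y
    using W(3)[OF that] by simp
  with V W open_shift[OF W(1), of t] show thesis
    by (intro that[of "V \<inter> {y. y - t \<in> W}"]) auto
qed

text \<open>A bump supported in an isolating neighbourhood of \<open>x\<close> is a competitor in
  \<open>variation_compact\<close>, and a function dominated by it sees the difference of the two
  combs at \<open>x\<close> only.\<close>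

lemma point_sup_norm_le:
  assumes "\<And>y. norm (a y - a (y - t)) \<le> \<delta>"
  shows "point_sup_norm (\<lambda>g. \<mu> g - translate_measure t \<mu> g) \<le> ennreal \<delta>"
  unfolding point_sup_norm_def
proof (rule SUP_least)
  fix x
  let ?\<omega> = "\<lambda>g. \<mu> g - translate_measure t \<mu> g"
  obtain V where V: "open V" "x \<in> V" "\<And>y. y \<in> \<Lambda> \<union> {y. y - t \<in> \<Lambda>} \<Longrightarrow> y \<in> V \<Longrightarrow> y = x"
    by (rule isolated_pair) blast
  obtain \<phi> :: "'g \<Rightarrow> real" where \<phi>: "\<phi> \<in> Cc" "range \<phi> \<subseteq> {0..1}" "\<phi> x = 1" "\<And>y. y \<notin> V \<Longrightarrow> \<phi> y = 0"
    by (rule bump_exists[OF lc V(1,2)]) blast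
  have r: "0 \<le> \<phi> x" "\<phi> x \<le> 1" for x using \<phi>(2) by (auto simp: image_subset_iff)
  have "variation_compact ?\<omega> {x} \<le> variation_fun ?\<omega> \<phi>"
    unfolding variation_compact_def using \<phi> r by (intro INF_lower) auto
  also have "\<dots> \<le> ennreal \<delta>"
    unfolding variation_fun_def
  proof (rule SUP_least)
    fix g :: "'g \<Rightarrow> complex" assume g: "g \<in> {g \<in> Cc. \<forall>x. norm (g x) \<le> \<phi> x}"
    have "norm (?\<omega> g) \<le> \<delta> * (\<Sum>y\<in>{x}. norm (g y))"
    proof (rule norm_diff_translate_le)
      show "y \<in> {x}" if "y \<in> \<Lambda> \<union> {y. y - t \<in> \<Lambda>}" "g y \<noteq> 0" for y
      proof -
        have "0 < norm (g y)" using that by simp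
        also have "\<dots> \<le> \<phi> y" using g by auto
        finally have "y \<in> V" using \<phi>(4) by fastforce
        then show ?thesis using V(3) that by blast
      qed
    qed (use g assms in auto)
    also have "\<dots> \<le> \<delta> * 1"
      using g r(2)[of x] order_trans[OF norm_ge_zero assms[of x]]
      by (intro mult_left_mono) (auto intro: order_trans)
    finally show "ennreal (norm (?\<omega> g)) \<le> ennreal \<delta>" by (intro ennreal_leI) simp
  qed
  finally show "variation_compact ?\<omega> {x} \<le> ennreal \<delta>" .
qed

end

section \<open>Norms over translates of a compact set\<close>

text \<open>This is the estimate shared by \<open>\<mu>\<close> and by its difference with a
  translate, so that \<open>norm_on_le\<close> serves both translation boundedness and norm-almost
  periodicity.\<close>

definition dominated :: "'g::topological_space functional \<Rightarrow> 'g set \<Rightarrow> real \<Rightarrow> bool" where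
  "dominated \<omega> \<Gamma> \<delta> \<longleftrightarrow> (\<forall>g\<in>Cc. \<forall>F. finite F \<longrightarrow> (\<forall>y\<in>\<Gamma>. g y \<noteq> 0 \<longrightarrow> y \<in> F) \<longrightarrow>
     norm (\<omega> g) \<le> \<delta> * (\<Sum>y\<in>F. norm (g y)))"

text \<open>The translate of \<open>f\<close> by \<open>x\<close> is a competitor for
  \<open>x + K\<close>. A function below it has values of norm at most \<open>B\<close> and meets at
  most \<open>N\<close> points of \<open>\<Gamma>\<close>, uniformly in \<open>x\<close>.\<close>

lemma norm_on_le:
  fixes f :: "'g::{topological_ab_group_add, t2_space} \<Rightarrow> real" and \<omega> :: "'g functional"
  assumes f: "f \<in> Cc" "\<And>x. 0 \<le> f x" "\<And>x. f x \<le> B" "\<And>x. x \<in> K \<Longrightarrow> 1 \<le> f x"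
    and Z: "\<And>x. f x \<noteq> 0 \<Longrightarrow> x \<in> Z"
    and \<delta>: "0 \<le> \<delta>" and "has_density \<Gamma> Z N" and "dominated \<omega> \<Gamma> \<delta>"
  shows "norm_on K \<omega> \<le> ennreal (\<delta> * (real N * B))"
proof -
  have N: "\<And>x. finite {y \<in> \<Gamma>. y - x \<in> Z} \<and> card {y \<in> \<Gamma>. y - x \<in> Z} \<le> N"
    and \<omega>: "\<And>g F. g \<in> Cc \<Longrightarrow> finite F \<Longrightarrow> (\<And>y. y \<in> \<Gamma> \<Longrightarrow> g y \<noteq> 0 \<Longrightarrow> y \<in> F) \<Longrightarrow>
        norm (\<omega> g) \<le> \<delta> * (\<Sum>y\<in>F. norm (g y))"
    using assms(7,8) by (simp_all add: has_density_def dominated_def)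
  have B: "0 \<le> B" using f(2,3) order_trans by blast
  show ?thesis
    unfolding norm_on_def
  proof (rule SUP_least)
    fix x
    have "variation_compact \<omega> ((+) x ` K) \<le> variation_fun \<omega> (\<lambda>y. f (y - x))"
      unfolding variation_compact_def using f by (intro INF_lower) (auto simp: Cc_shift)
    also have "\<dots> \<le> ennreal (\<delta> * (real N * B))"
      unfolding variation_fun_def
    proof (rule SUP_least)
      fix g :: "'g \<Rightarrow> complex" assume g: "g \<in> {g \<in> Cc. \<forall>y. norm (g y) \<le> f (y - x)}"
      let ?F = "{y \<in> \<Gamma>. y - x \<in> Z}"
      have "norm (\<omega> g) \<le> \<delta> * (\<Sum>y\<in>?F. norm (g y))"
      proof (rule \<omega>)
        show "y \<in> ?F" if "y \<in> \<Gamma>" "g y \<noteq> 0" for y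
        proof -
          have "0 < norm (g y)" using that by simp
          also have "\<dots> \<le> f (y - x)" using g by auto
          finally show ?thesis using Z[of "y - x"] that by simp
        qed
      qed (use g N in auto)
      also have "(\<Sum>y\<in>?F. norm (g y)) \<le> (\<Sum>y\<in>?F. B)"
        using g f(3) by (intro sum_mono) (auto intro: order_trans)
      also have "\<dots> \<le> real N * B" using N[of x] B by (auto intro!: mult_right_mono)
      finally show "ennreal (norm (\<omega> g)) \<le> ennreal (\<delta> * (real N * B))"
        using \<delta> by (intro ennreal_leI) (simp add: mult_left_mono)
    qed
    finally show "variation_compact \<omega> ((+) x ` K) \<le> ennreal (\<delta> * (real N * B))" .
  qed
qed

context discrete_comb
begin

lemma translation_boundedI:
  assumes "\<And>x. norm (a x) \<le> C"
  shows "translation_bounded \<mu>"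
  unfolding translation_bounded_def
proof (intro allI impI)
  fix K :: "'g set" assume "compact K"
  obtain f :: "'g \<Rightarrow> real" and B where f: "f \<in> Cc" "\<And>x. 0 \<le> f x" "\<And>x. f x \<le> B" "\<And>x. x \<in> K \<Longrightarrow> 1 \<le> f x"
    by (rule cutoff_exists[OF lc \<open>compact K\<close>]) blast
  obtain Z where Z: "compact Z" "\<And>x. f x \<noteq> 0 \<Longrightarrow> x \<in> Z" using Cc_support[OF f(1)] by blast
  obtain N where N: "has_density \<Lambda> Z N"
    by (rule uniformly_discrete_has_density[OF discrete Z(1)])
  have "norm_on K \<mu> \<le> ennreal (C * (real N * B))"
  proof (rule norm_on_le[OF f Z(2)])
    show "0 \<le> C" using order_trans[OF norm_ge_zero assms] .
    show "has_density \<Lambda> Z N" by (rule N)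
    show "dominated \<mu> \<Lambda> C"
      unfolding dominated_def
    proof (intro ballI allI impI)
      fix g :: "'g \<Rightarrow> complex" and F
      assume g: "g \<in> Cc" "finite F" "\<forall>y\<in>\<Lambda>. g y \<noteq> 0 \<longrightarrow> y \<in> F"
      have "\<mu> g = (\<Sum>y\<in>F. a y * g y)" by (rule eval) (use g in auto)
      also have "norm \<dots> \<le> (\<Sum>y\<in>F. norm (a y * g y))" by (rule norm_sum)
      also have "\<dots> \<le> (\<Sum>y\<in>F. C * norm (g y))"
        using assms by (intro sum_mono) (auto simp: norm_mult intro!: mult_right_mono)
      finally show "norm (\<mu> g) \<le> C * (\<Sum>y\<in>F. norm (g y))" by (simp add: sum_distrib_left)
    qed
  qed
  then show "norm_on K \<mu> < \<infinity>" using ennreal_less_top le_less_trans by (metis infinity_ennreal_def)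
qed

text \<open>The constant depends on \<open>K\<close> but not on \<open>t\<close>: the union of
  \<open>\<Lambda>\<close> and \<open>\<Lambda> + t\<close> satisfies twice the density bound of
  \<open>\<Lambda>\<close>.\<close>

lemma norm_on_diff_le:
  assumes "compact K"
  shows "\<exists>C\<ge>0. \<forall>t \<delta>. (\<forall>y. norm (a y - a (y - t)) \<le> \<delta>) \<longrightarrow>
    norm_on K (\<lambda>g. \<mu> g - translate_measure t \<mu> g) \<le> ennreal (\<delta> * C)"
proof -
  obtain f :: "'g \<Rightarrow> real" and B where f: "f \<in> Cc" "\<And>x. 0 \<le> f x" "\<And>x. f x \<le> B" "\<And>x. x \<in> K \<Longrightarrow> 1 \<le> f x"
    by (rule cutoff_exists[OF lc assms]) blast
  obtain Z where Z: "compact Z" "\<And>x. f x \<noteq> 0 \<Longrightarrow> x \<in> Z" using Cc_support[OF f(1)] by blast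
  obtain N where "has_density \<Lambda> Z N"
    by (rule uniformly_discrete_has_density[OF discrete Z(1)])
  then have N: "\<And>x. finite {y \<in> \<Lambda>. y - x \<in> Z}" "\<And>x. card {y \<in> \<Lambda>. y - x \<in> Z} \<le> N"
    by (simp_all add: has_density_def)
  show ?thesis
  proof (intro exI[of _ "real (2 * N) * B"] conjI allI impI)
    show "0 \<le> real (2 * N) * B" using order_trans[OF f(2,3)] by simp
    fix t \<delta> assume "\<forall>y. norm (a y - a (y - t)) \<le> \<delta>"
    then have \<delta>: "\<And>y. norm (a y - a (y - t)) \<le> \<delta>" by blast
    let ?\<Gamma> = "\<Lambda> \<union> {y. y - t \<in> \<Lambda>}"
    show "norm_on K (\<lambda>g. \<mu> g - translate_measure t \<mu> g) \<le> ennreal (\<delta> * (real (2 * N) * B))"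
    proof (rule norm_on_le[OF f Z(2)])
      show "0 \<le> \<delta>" using order_trans[OF norm_ge_zero \<delta>] .
      show "dominated (\<lambda>g. \<mu> g - translate_measure t \<mu> g) ?\<Gamma> \<delta>"
        unfolding dominated_def by (intro ballI allI impI norm_diff_translate_le) (use \<delta> in auto)
      show "has_density ?\<Gamma> Z (2 * N)"
        unfolding has_density_def
      proof
        fix x
        \<comment> \<open>Points of \<open>\<Lambda> + t\<close> seen from \<open>x\<close> are
          points of \<open>\<Lambda>\<close> seen from \<open>x - t\<close>, moved by
          \<open>t\<close>.\<close>
        let ?A = "{y \<in> \<Lambda>. y - x \<in> Z}" and ?B = "{y \<in> \<Lambda>. y - (x - t) \<in> Z}"
        have sub: "{y \<in> ?\<Gamma>. y - x \<in> Z} \<subseteq> ?A \<union> (\<lambda>y. y + t) ` ?B"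
        proof
          fix y assume y: "y \<in> {y \<in> ?\<Gamma>. y - x \<in> Z}"
          show "y \<in> ?A \<union> (\<lambda>y. y + t) ` ?B"
          proof (cases "y \<in> \<Lambda>")
            case False
            then have "y - t \<in> ?B" using y by (simp add: algebra_simps)
            then show ?thesis by (intro UnI2 image_eqI[of _ _ "y - t"]) simp_all
          qed (use y in auto)
        qed
        have "card (?A \<union> (\<lambda>y. y + t) ` ?B) \<le> card ?A + card ((\<lambda>y. y + t) ` ?B)" by (rule card_Un_le)
        also have "\<dots> \<le> card ?A + card ?B" using N(1) by (intro add_left_mono card_image_le)
        also have "\<dots> \<le> 2 * N" using N(2)[of x] N(2)[of "x - t"] by linarith
        finally show "finite {y \<in> ?\<Gamma>. y - x \<in> Z} \<and> card {y \<in> ?\<Gamma>. y - x \<in> Z} \<le> 2 * N"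
          using sub N(1) by (meson card_mono finite_UnI finite_imageI finite_subset order_trans)
      qed
    qed
  qed
qed

end

section \<open>Positive definiteness of the point masses\<close>

lemma haar_measurable:
  assumes "haar_measure m" "continuous_on UNIV f"
  shows "f \<in> borel_measurable m"
proof -
  have "sets m = sets borel" using assms(1) by (simp add: haar_measure_def)
  then show ?thesis
    using borel_measurable_continuous_onI[OF assms(2)] by (simp cong: measurable_cong_sets)
qed

text \<open>The preimage of a set under translation by \<open>t\<close> is its image under
  translation by \<open>- t\<close>; so invariance says that the push-forward of \<open>m\<close> is
  \<open>m\<close>, and the change of variables applies.\<close>

lemma haar_integral_shift:
  fixes f :: "'g::topological_ab_group_add \<Rightarrow> complex"
  assumes m: "haar_measure m" and f: "continuous_on UNIV f"
  shows "(LINT y|m. f (t + y)) = (LINT y|m. f y)"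
proof -
  have sets: "sets m = sets borel" and inv: "\<And>t A. A \<in> sets borel \<Longrightarrow> emeasure m ((+) t ` A) = emeasure m A"
    using m by (auto simp: haar_measure_def)
  have space: "space m = UNIV" using sets_eq_imp_space_eq[OF sets] by simp
  have "(+) t \<in> borel_measurable (borel :: 'g measure)"
    by (intro borel_measurable_continuous_onI continuous_intros)
  then have meas: "(+) t \<in> measurable m m"
    by (simp add: measurable_cong_sets[OF sets sets])
  have "distr m m ((+) t) = m"
  proof (rule measure_eqI)
    fix A assume "A \<in> sets (distr m m ((+) t))"
    then have A: "A \<in> sets m" by simp
    have "(+) t -` A = (+) (- t) ` A"
      by (auto simp: image_iff intro!: bexI[of _ "t + x" for x])
    with A show "emeasure (distr m m ((+) t)) A = emeasure m A"
      using inv[of A "- t"] sets by (simp add: emeasure_distr[OF meas] space)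
  qed simp
  then have "(LINT y|m. f y) = (LINT y|distr m m ((+) t). f y)" by simp
  also have "\<dots> = (LINT y|m. f (t + y))"
    using haar_measurable[OF m f] by (rule integral_distr[OF meas])
  finally show ?thesis ..
qed

text \<open>By the Lindelof property countably many translates of \<open>U\<close> cover the group,
  so a null \<open>U\<close> would make the whole group null.\<close>

lemma haar_open_pos:
  fixes U :: "'g::{topological_ab_group_add, second_countable_topology} set"
  assumes m: "haar_measure m" and U: "open U" "U \<noteq> {}"
  shows "emeasure m U \<noteq> 0"
proof
  assume 0: "emeasure m U = 0"
  have sets: "sets m = sets borel" and inv: "\<And>t A. A \<in> sets borel \<Longrightarrow> emeasure m ((+) t ` A) = emeasure m A"
    and nz: "emeasure m UNIV \<noteq> 0"
    using m by (auto simp: haar_measure_def)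
  obtain z where z: "z \<in> U" using U(2) by blast
  have eq: "(+) x ` U = {y. y - x \<in> U}" for x
    by (auto simp: image_iff intro!: bexI[of _ "y - x" for y])
  have op: "open ((+) x ` U)" for x unfolding eq by (rule open_shift[OF U(1)])
  obtain \<F> where F: "\<F> \<subseteq> range (\<lambda>x. (+) x ` U)" "countable \<F>" "\<Union>\<F> = (\<Union>x. (+) x ` U)"
    by (rule Lindelof[of "range (\<lambda>x. (+) x ` U)"], use op in force) blast
  have "y \<in> (+) (y - z) ` U" for y using z by (auto simp: image_iff intro!: bexI[of _ z])
  then have "\<Union>\<F> = UNIV" unfolding F(3) by blast
  moreover have "(\<Union>A\<in>\<F>. A) \<in> null_sets m"
  proof (rule null_sets_UN'[OF F(2)])
    fix A assume "A \<in> \<F>"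
    then obtain x where "A = (+) x ` U" using F(1) by auto
    with 0 inv[of U x] U(1) op[of x] sets show "A \<in> null_sets m"
      by (auto simp: null_sets_def)
  qed
  ultimately show False using nz by (simp add: null_sets_def)
qed

lemma haar_Cc_integrable:
  fixes f :: "'g::{topological_ab_group_add, t2_space} \<Rightarrow> complex"
  assumes m: "haar_measure m" and f: "f \<in> Cc"
  shows "integrable m f"
proof -
  obtain K where K: "compact K" "\<And>x. f x \<noteq> 0 \<Longrightarrow> x \<in> K" using Cc_support[OF f] by blast
  have "compact (f ` K)"
    using K(1) Cc_continuous[OF f] by (metis compact_continuous_image continuous_on_subset subset_UNIV)
  then obtain B where "\<And>x. x \<in> K \<Longrightarrow> norm (f x) \<le> B"
    using compact_imp_bounded bounded_iff by (metis imageI)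
  moreover have "K \<in> sets m" "emeasure m K < \<infinity>"
    using m K(1) by (auto simp: haar_measure_def compact_imp_closed)
  ultimately show ?thesis
    using K haar_measurable[OF m Cc_continuous[OF f]]
    by (intro integrableI_bounded_set[of K _ _ B]) auto
qed

section \<open>Autocorrelation of a bump function\<close>

text \<open>For real \<open>\<phi>\<close> this is the convolution of \<open>\<phi>\<close> with its
  reflection.\<close>

definition autocorrelation :: "'g::topological_ab_group_add measure \<Rightarrow> ('g \<Rightarrow> real) \<Rightarrow> 'g \<Rightarrow> complex" where
  "autocorrelation m \<phi> z = (LINT y|m. of_real (\<phi> y * \<phi> (y - z)))"

context
  fixes m :: "'g::{topological_ab_group_add, t2_space, second_countable_topology} measure"
    and \<phi> :: "'g \<Rightarrow> real" and W :: "'g set"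
  assumes m: "haar_measure m"
    and \<phi>: "\<phi> \<in> Cc" "range \<phi> \<subseteq> {0..1}" "\<phi> 0 = 1" "\<And>y. y \<notin> W \<Longrightarrow> \<phi> y = 0"
begin

lemma bump_range: "0 \<le> \<phi> x" "\<phi> x \<le> 1"
  using \<phi>(2) by (auto simp: image_subset_iff)

lemma bump_product_Cc: "(\<lambda>y. of_real (\<phi> (y - s) * \<phi> (y - t)) :: complex) \<in> Cc"
proof -
  have *: "(\<lambda>y. \<phi> (y - x)) \<in> Cc" for x by (rule Cc_shift[OF \<phi>(1)])
  obtain K where K: "compact K" "\<And>x. \<phi> (x - s) \<noteq> 0 \<Longrightarrow> x \<in> K" by (rule Cc_support[OF *]) blast
  show ?thesis
    using K Cc_continuous[OF *] by (intro CcI[of _ K] continuous_intros) auto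
qed

text \<open>Substitute \<open>s + y\<close> for \<open>y\<close>. Cross terms between translated
  bumps are thus translates of one single function.\<close>

lemma autocorrelation_shift:
  "(LINT y|m. of_real (\<phi> (y - s) * \<phi> (y - x - t)) :: complex) = autocorrelation m \<phi> (x - (s - t))"
proof -
  have "(\<lambda>y. of_real (\<phi> (y - s) * \<phi> (y - x - t)) :: complex) \<in> Cc"
    using bump_product_Cc[of s "x + t"] by (simp add: diff_diff_eq)
  from haar_integral_shift[OF m Cc_continuous[OF this], of s]
  show ?thesis by (simp add: autocorrelation_def algebra_simps)
qed

text \<open>If no such \<open>v\<close> and \<open>w\<close> existed, the integrand would vanish
  identically.\<close>

lemma autocorrelation_support:
  assumes "autocorrelation m \<phi> z \<noteq> 0"
  obtains v w where "\<phi> v \<noteq> 0" "\<phi> w \<noteq> 0" "z = v - w"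
proof -
  have "\<exists>y. \<phi> y * \<phi> (y - z) \<noteq> 0"
  proof (rule ccontr)
    assume "\<not> ?thesis"
    then have "(\<lambda>y. of_real (\<phi> y * \<phi> (y - z)) :: complex) = (\<lambda>_. 0)" by auto
    with assms show False by (simp only: autocorrelation_def Bochner_Integration.integral_zero)
  qed
  then show thesis using that[of y "y - z" for y] by auto
qed

text \<open>The support lies in \<open>K - K\<close>. Continuity follows by dominated convergence
  with \<open>\<phi>\<close> itself as majorant; sequences suffice by first countability.\<close>

lemma autocorrelation_Cc: "autocorrelation m \<phi> \<in> Cc"
proof -
  obtain K where K: "compact K" "\<And>x. \<phi> x \<noteq> 0 \<Longrightarrow> x \<in> K" using Cc_support[OF \<phi>(1)] by blast
  show ?thesis
  proof (rule CcI)
    show "compact ((\<lambda>p. fst p - snd p) ` (K \<times> K))"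
      using K(1) by (intro compact_continuous_image compact_Times continuous_intros) auto
    show "z \<in> (\<lambda>p. fst p - snd p) ` (K \<times> K)" if "autocorrelation m \<phi> z \<noteq> 0" for z
      by (rule autocorrelation_support[OF that]) (use K(2) in \<open>force simp: image_iff\<close>)
    show "continuous_on UNIV (autocorrelation m \<phi>)"
    proof (rule continuous_on_sequentiallyI)
      fix u :: "nat \<Rightarrow> 'g" and z assume u: "u \<longlonglongrightarrow> z"
      have cont: "continuous_on UNIV \<phi>" by (rule Cc_continuous[OF \<phi>(1)])
      have meas: "(\<lambda>y. of_real (\<phi> y * \<phi> (y - x)) :: complex) \<in> borel_measurable m" for x
        using haar_measurable[OF m Cc_continuous[OF bump_product_Cc[of 0 x]]] by simp
      show "(\<lambda>n. autocorrelation m \<phi> (u n)) \<longlonglongrightarrow> autocorrelation m \<phi> z"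
        unfolding autocorrelation_def
      proof (rule integral_dominated_convergence[where w = \<phi>])
        show "integrable m \<phi>"
          using haar_Cc_integrable[OF m Cc_of_real[OF \<phi>(1)]] by (simp add: complex_of_real_integrable_eq)
        have "(\<lambda>n. \<phi> (y - u n)) \<longlonglongrightarrow> \<phi> (y - z)" for y
        proof (rule isCont_tendsto_compose[of _ \<phi>])
          show "isCont \<phi> (y - z)" using cont by (simp add: continuous_on_eq_continuous_at)
        qed (intro tendsto_intros u)
        then show "AE y in m. (\<lambda>n. of_real (\<phi> y * \<phi> (y - u n)) :: complex)
            \<longlonglongrightarrow> of_real (\<phi> y * \<phi> (y - z))"
          by (intro always_eventually allI tendsto_intros)
        show "AE y in m. norm (of_real (\<phi> y * \<phi> (y - u n)) :: complex) \<le> \<phi> y" for n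
        proof (intro always_eventually allI)
          fix y
          have "\<phi> y * \<phi> (y - u n) \<le> \<phi> y * 1" using bump_range by (intro mult_left_mono)
          then show "norm (of_real (\<phi> y * \<phi> (y - u n)) :: complex) \<le> \<phi> y"
            using bump_range by (simp add: norm_mult)
        qed
      qed (rule meas)+
    qed
  qed
qed

text \<open>The integrand is positive on an open neighbourhood of 0, which is not a null
  set.\<close>

lemma autocorrelation_zero: "\<exists>r>0. autocorrelation m \<phi> 0 = of_real r"
proof (intro exI conjI)
  let ?r = "LINT y|m. \<phi> y * \<phi> y"
  show "autocorrelation m \<phi> 0 = of_real ?r"
    by (simp add: autocorrelation_def del: of_real_mult)
  have int: "integrable m (\<lambda>y. \<phi> y * \<phi> y)"
    using haar_Cc_integrable[OF m bump_product_Cc[of 0 0]]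
    by (simp add: complex_of_real_integrable_eq del: of_real_mult)
  have cont: "continuous_on UNIV \<phi>" by (rule Cc_continuous[OF \<phi>(1)])
  let ?A = "\<phi> -` {0<..}"
  have A: "open ?A" "0 \<in> ?A" using open_vimage[OF _ cont, of "{0<..}"] \<phi>(3) by auto
  have "\<not> (AE y in m. \<phi> y * \<phi> y = 0)"
  proof
    assume "AE y in m. \<phi> y * \<phi> y = 0"
    then have "AE y in m. y \<notin> ?A" by eventually_elim auto
    moreover have "?A \<in> sets m" using A(1) m by (simp add: haar_measure_def)
    ultimately have "emeasure m ?A = 0"
      by (metis AE_iff_null_sets null_setsD1)
    with haar_open_pos[OF m A(1)] A(2) show False by blast
  qed
  moreover have "0 \<le> ?r" by (intro integral_nonneg_AE) auto
  ultimately show "0 < ?r"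
    using integral_nonneg_eq_0_iff_AE[OF int] by (auto simp: less_le)
qed

end


text \<open>The function tested is a combination of translates of \<open>\<psi>\<close> centred at
  the differences \<open>p i - p j\<close>. Each translate is so narrow that it meets
  \<open>\<Lambda>\<close> at most in its centre, so \<open>\<mu> F\<close> is the quadratic form
  times \<open>\<psi> 0 > 0\<close>. The points may repeat and may lie anywhere in the
  group.\<close>

theorem point_masses_positive_definite:
  fixes m :: "'g::{topological_ab_group_add, t2_space, second_countable_topology} measure"
    and c :: "nat \<Rightarrow> complex" and p :: "nat \<Rightarrow> 'g"
  assumes comb: "discrete_comb \<mu> \<Lambda> a" and m: "haar_measure m" and pd: "positive_definite m \<mu>"
  shows "(\<Sum>i<n. \<Sum>j<n. c i * cnj (c j) * a (p i - p j)) \<in> \<real>\<^sub>\<ge>\<^sub>0"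
proof -
  interpret discrete_comb \<mu> \<Lambda> a by (rule comb)
  define D where "D = (\<lambda>(i, j). p i - p j) ` ({..<n} \<times> {..<n})"
  have D: "finite D" "\<And>i j. i < n \<Longrightarrow> j < n \<Longrightarrow> p i - p j \<in> D" by (auto simp: D_def)
  have "\<forall>z. \<exists>V. open V \<and> z \<in> V \<and> (\<forall>y\<in>\<Lambda>. y \<in> V \<longrightarrow> y = z)"
    using uniformly_discrete_isolated[OF discrete] by metis
  then obtain V where V: "\<And>z. open (V z)" "\<And>z. z \<in> V z" "\<And>z y. y \<in> \<Lambda> \<Longrightarrow> y \<in> V z \<Longrightarrow> y = z"
    by metis
  \<comment> \<open>Each isolating neighbourhood \<open>V z\<close> is moved to the origin; the
    finite intersection isolates all differences at once.\<close>
  have "open (\<Inter>z\<in>D. {y. y - (- z) \<in> V z})" 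
    by (intro open_INT D(1) ballI open_shift V(1))
  moreover have "0 \<in> (\<Inter>z\<in>D. {y. y - (- z) \<in> V z})" using V(2) by auto
  ultimately obtain W where W: "open W" "0 \<in> W"
      "\<And>v w. v \<in> W \<Longrightarrow> w \<in> W \<Longrightarrow> v - w \<in> (\<Inter>z\<in>D. {y. y - (- z) \<in> V z})"
    by (rule difference_neighbourhood) blast
  obtain \<phi> :: "'g \<Rightarrow> real" where \<phi>: "\<phi> \<in> Cc" "range \<phi> \<subseteq> {0..1}" "\<phi> 0 = 1" "\<And>y. y \<notin> W \<Longrightarrow> \<phi> y = 0"
    by (rule bump_exists[OF lc W(1,2)]) blast
  define \<psi> where "\<psi> = autocorrelation m \<phi>"
  have \<psi>_Cc: "\<psi> \<in> Cc" unfolding \<psi>_def by (rule autocorrelation_Cc[OF m \<phi>])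
  have \<psi>_0: "y = z" if z: "z \<in> D" "y \<in> \<Lambda>" "\<psi> (y - z) \<noteq> 0" for y z
  proof -
    obtain v w where vw: "\<phi> v \<noteq> 0" "\<phi> w \<noteq> 0" "y - z = v - w"
      using autocorrelation_support[OF m \<phi>] z(3) unfolding \<psi>_def by blast
    have "v - w \<in> (\<Inter>z\<in>D. {y. y - (- z) \<in> V z})" using W(3)[of v w] \<phi>(4) vw by blast
    then have "y - z - (- z) \<in> V z" using z(1) vw(3) by auto
    then show ?thesis using V(3)[OF z(2)] by simp
  qed
  define f where "f y = (\<Sum>i<n. c i * of_real (\<phi> (y - p i)))" for y
  have f_Cc: "f \<in> Cc"
    unfolding f_def by (intro Cc_sum Cc_cmult Cc_of_real Cc_shift \<phi>)
  define F where "F = convolve m f (reflect_cnj f)"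
  have F: "F x = (\<Sum>i<n. \<Sum>j<n. c i * cnj (c j) * \<psi> (x - (p i - p j)))" for x
  proof -
    have "f y * cnj (f (y - x)) = (\<Sum>i<n. \<Sum>j<n. c i * cnj (c j) * of_real (\<phi> (y - p i) * \<phi> (y - x - p j)))" for y
      unfolding f_def cnj_sum sum_product by (intro sum.cong refl) (simp add: mult_ac)
    then have "F x = (LINT y|m. (\<Sum>i<n. \<Sum>j<n. c i * cnj (c j) * of_real (\<phi> (y - p i) * \<phi> (y - x - p j))))"
      by (simp add: F_def convolve_def reflect_cnj_def)
    also have "\<dots> = (\<Sum>i<n. \<Sum>j<n. c i * cnj (c j) * (LINT y|m. of_real (\<phi> (y - p i) * \<phi> (y - x - p j))))"
    proof -
      have int: "integrable m (\<lambda>y. of_real (\<phi> (y - s) * \<phi> (y - x - t)) :: complex)" for s t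
        using haar_Cc_integrable[OF m bump_product_Cc[OF m \<phi>, where s = s and t = "x + t"]]
        by (simp add: diff_diff_eq)
      show ?thesis
        by (subst Bochner_Integration.integral_sum, (intro Bochner_Integration.integrable_sum integrable_mult_right int)[1],
            subst Bochner_Integration.integral_sum, (intro integrable_mult_right int)[1], simp only: integral_mult_right_zero)
    qed
    finally show ?thesis by (simp only: autocorrelation_shift[OF m \<phi>] \<psi>_def)
  qed
  have F_Cc: "F \<in> Cc"
    unfolding F[abs_def] by (intro Cc_sum Cc_cmult Cc_shift \<psi>_Cc)
  have "\<mu> F = (\<Sum>y\<in>D. a y * F y)"
  proof (rule eval[OF F_Cc D(1)])
    fix y assume y: "y \<in> \<Lambda>" "F y \<noteq> 0"
    show "y \<in> D"
    proof (rule ccontr)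
      assume "y \<notin> D"
      then have "\<psi> (y - (p i - p j)) = 0" if "i < n" "j < n" for i j
        using \<psi>_0[OF D(2)[OF that] y(1)] D(2)[OF that] by auto
      then have "F y = 0" unfolding F by simp
      with y(2) show False by simp
    qed
  qed
  also have "\<dots> = (\<Sum>y\<in>D. \<Sum>i<n. \<Sum>j<n. c i * cnj (c j) * (a y * \<psi> (y - (p i - p j))))"
    by (simp add: F sum_distrib_left algebra_simps)
  also have "\<dots> = (\<Sum>i<n. \<Sum>j<n. c i * cnj (c j) * (\<Sum>y\<in>D. a y * \<psi> (y - (p i - p j))))"
    by (simp add: sum_distrib_left sum.swap[of _ D])
  also have "\<dots> = (\<Sum>i<n. \<Sum>j<n. c i * cnj (c j) * (a (p i - p j) * \<psi> 0))"
  \<comment> \<open>Away from the centre \<open>p i - p j\<close>, either \<open>\<psi>\<close>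
    vanishes (on \<open>\<Lambda>\<close>) or \<open>a\<close> does (off
    \<open>\<Lambda>\<close>).\<close>
  proof (intro sum.cong refl arg_cong2[where f = "(*)"])
    fix i j assume "i \<in> {..<n}" "j \<in> {..<n}"
    then have z: "p i - p j \<in> D" using D(2) by auto
    have "a y * \<psi> (y - (p i - p j)) = 0" if "y \<in> D - {p i - p j}" for y
      using \<psi>_0[OF z, of y] off[of y] that by auto
    then have "(\<Sum>y\<in>D - {p i - p j}. a y * \<psi> (y - (p i - p j))) = 0" by (intro sum.neutral ballI)
    then show "(\<Sum>y\<in>D. a y * \<psi> (y - (p i - p j))) = a (p i - p j) * \<psi> 0"
      by (subst sum.remove[OF D(1) z]) simp
  qed
  also have "\<dots> = (\<Sum>i<n. \<Sum>j<n. c i * cnj (c j) * a (p i - p j)) * \<psi> 0"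
    by (simp add: sum_distrib_right mult.assoc)
  finally have eq: "\<mu> F = (\<Sum>i<n. \<Sum>j<n. c i * cnj (c j) * a (p i - p j)) * \<psi> 0" .
  obtain r where r: "0 < r" "\<psi> 0 = of_real r"
    using autocorrelation_zero[OF m \<phi>] unfolding \<psi>_def by blast
  have "\<mu> F \<in> \<real>\<^sub>\<ge>\<^sub>0" using pd f_Cc by (simp add: positive_definite_def F_def)
  then have "\<mu> F * of_real (1 / r) \<in> \<real>\<^sub>\<ge>\<^sub>0"
    using r(1) by (intro nonneg_Reals_mult_I) auto
  moreover have "\<mu> F * of_real (1 / r) = (\<Sum>i<n. \<Sum>j<n. c i * cnj (c j) * a (p i - p j))"
    using r by (simp add: eq)
  ultimately show ?thesis by simp
qed

section \<open>Positive definite functions\<close>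

locale positive_definite_function =
  fixes a :: "'g::ab_group_add \<Rightarrow> complex"
  assumes positive: "\<And>(n :: nat) c p. (\<Sum>i<n. \<Sum>j<n. c i * cnj (c j) * a (p i - p j)) \<in> \<real>\<^sub>\<ge>\<^sub>0"
begin

definition "a0 = Re (a 0)"

lemma a_zero: "a 0 = of_real a0" "0 \<le> a0"
  using positive[where n = 1 and c = "\<lambda>_. 1" and p = "\<lambda>_. 0"]
  by (auto simp: a0_def complex_nonneg_Reals_iff complex_eq_iff)

text \<open>The forms at the points \<open>x\<close>, 0 with weights 1, 1 and \<i>, 1 are real; the
  first gives opposite imaginary parts, the second equal real parts.\<close>

lemma hermitian: "a (- x) = cnj (a x)"
proof -
  have 1: "2 * of_real a0 + a x + a (- x) \<in> \<real>\<^sub>\<ge>\<^sub>0"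
    using positive[where n = 2 and c = "\<lambda>_. 1" and p = "\<lambda>i. if i = 0 then x else 0"]
    by (simp add: numeral_2_eq_2 lessThan_Suc a_zero algebra_simps)
  have 2: "2 * of_real a0 + \<i> * a x - \<i> * a (- x) \<in> \<real>\<^sub>\<ge>\<^sub>0"
    using positive[where n = 2 and c = "\<lambda>i. if i = 0 then \<i> else 1" and p = "\<lambda>i. if i = 0 then x else 0"]
    by (simp add: numeral_2_eq_2 lessThan_Suc a_zero algebra_simps)
  from 1 2 show ?thesis by (auto simp: complex_nonneg_Reals_iff complex_eq_iff)
qed

text \<open>The form at the points \<open>x\<close>, 0 with weights \<open>r\<close> and
  \<open>- a x\<close>. The parameter \<open>r\<close> stays free: \<open>r = a0\<close> gives the
  bound of \<open>a\<close> by \<open>a0\<close>, and \<open>r = 1\<close> covers the degenerate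
  case \<open>a0 = 0\<close>.\<close>

lemma quadratic_two:
  fixes r :: real
  shows "0 \<le> a0 * (r\<^sup>2 + (norm (a x))\<^sup>2) - 2 * r * (norm (a x))\<^sup>2"
proof -
  have "of_real r * of_real r * a 0 + of_real r * cnj (- a x) * a x
      + (- a x) * of_real r * a (- x) + (- a x) * cnj (- a x) * a 0 \<in> \<real>\<^sub>\<ge>\<^sub>0"
    using positive[where n = 2 and c = "\<lambda>i. if i = 0 then of_real r else - a x"
        and p = "\<lambda>i. if i = 0 then x else 0"]
    by (simp add: numeral_2_eq_2 lessThan_Suc algebra_simps)
  then have "0 \<le> Re (of_real r * of_real r * a 0 + of_real r * cnj (- a x) * a x
      + (- a x) * of_real r * a (- x) + (- a x) * cnj (- a x) * a 0)"
    by (simp add: complex_nonneg_Reals_iff)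
  then show ?thesis
    by (simp add: a_zero hermitian cmod_power2) (simp add: algebra_simps power2_eq_square)
qed

lemma norm_le: "norm (a x) \<le> a0"
proof (cases "a0 = 0")
  case True
  then show ?thesis using quadratic_two[of 1 x] by simp
next
  case False
  then have p: "0 < a0" using a_zero(2) by simp
  have "0 \<le> a0 * (a0\<^sup>2 - (norm (a x))\<^sup>2)"
    using quadratic_two[of a0 x] by (simp add: algebra_simps)
  then have "(norm (a x))\<^sup>2 \<le> a0\<^sup>2" using p by (simp add: zero_le_mult_iff)
  then show ?thesis using p by (simp add: power2_le_iff_abs_le)
qed

text \<open>Krein's inequality: positivity at the points \<open>x + t\<close>, \<open>x\<close>, \<open>0\<close> with the
  weights \<open>a(0)\<close>, \<open>- a(0)\<close> and \<open>a(x) - a(x + t)\<close>.\<close>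

lemma krein: "(norm (a (x + t) - a x))\<^sup>2 \<le> 2 * a0 * (a0 - Re (a t))"
proof (cases "a0 = 0")
  case True
  then show ?thesis using norm_le[of "x + t"] norm_le[of x] by simp
next
  case False
  then have p: "0 < a0" using a_zero(2) by simp
  define D where "D = a (x + t) - a x"
  have ax: "a (x + t) = a x + D" by (simp add: D_def)
  have sub: "- x - t = - (x + t)" by simp
  let ?r = "of_real a0 :: complex"
  have "?r * ?r * a 0 - ?r * ?r * a t - ?r * cnj D * a (x + t)
      - ?r * ?r * a (- t) + ?r * ?r * a 0 + ?r * cnj D * a x
      - D * ?r * a (- (x + t)) + D * ?r * a (- x) + D * cnj D * a 0 \<in> \<real>\<^sub>\<ge>\<^sub>0"
    using positive[where n = 3 and c = "\<lambda>i. if i = 0 then ?r else if i = 1 then - ?r else - D"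
        and p = "\<lambda>i. if i = 0 then x + t else if i = 1 then x else 0"]
    by (simp add: numeral_3_eq_3 lessThan_Suc sub algebra_simps)
  then have "0 \<le> Re (?r * ?r * a 0 - ?r * ?r * a t - ?r * cnj D * a (x + t)
      - ?r * ?r * a (- t) + ?r * ?r * a 0 + ?r * cnj D * a x
      - D * ?r * a (- (x + t)) + D * ?r * a (- x) + D * cnj D * a 0)"
    by (simp add: complex_nonneg_Reals_iff)
  \<comment> \<open>After substituting \<open>a x + D\<close> for \<open>a (x + t)\<close> all terms
    in \<open>a x\<close> cancel, and the three remaining multiples of the squared norm of
    \<open>D\<close> add up to \<open>- a0\<close>.\<close>
  also have "\<dots> = a0 * (2 * a0 * (a0 - Re (a t)) - ((Re D)\<^sup>2 + (Im D)\<^sup>2))"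
    unfolding hermitian a_zero(1) ax by (simp add: algebra_simps power2_eq_square)
  finally have "0 \<le> 2 * a0 * (a0 - Re (a t)) - ((Re D)\<^sup>2 + (Im D)\<^sup>2)"
    using p by (simp add: zero_le_mult_iff)
  then show ?thesis by (simp add: D_def[symmetric] cmod_power2)
qed

end

section \<open>Large point masses\<close>

text \<open>The value of \<open>\<mu> * g\<close> at \<open>t\<close> is
  \<open>a y * \<phi> (t - y)\<close> for the only possible \<open>y\<close> of
  \<open>\<Lambda>\<close> in \<open>t + U\<close>, and its value at 0 is \<open>r\<close>. At an
  almost period the two are close, and \<open>\<phi> \<le> 1\<close> bounds the real part of
  \<open>a y\<close> from below.\<close>

lemma (in discrete_comb) large_masses_relatively_dense:
  assumes ap: "strongly_almost_periodic \<mu>" and a0: "a 0 = of_real r" "0 < r" and e: "0 < e"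
  shows "relatively_dense {x \<in> \<Lambda>. r - e \<le> Re (a x)}"
proof -
  \<comment> \<open>With \<open>e' < r\<close> the value at an almost period cannot vanish, which
    forces a point \<open>y\<close> to exist and the real part of \<open>a y\<close> to be
    positive.\<close>
  define e' where "e' = min e (r / 2)"
  have e': "0 < e'" "e' \<le> e" "e' < r" using e a0(2) by (auto simp: e'_def)
  have 0: "0 \<in> \<Lambda>" using off[of 0] a0 by auto
  obtain U where U: "open U" "0 \<in> U"
    "\<And>p q z. p \<in> \<Lambda> \<Longrightarrow> q \<in> \<Lambda> \<Longrightarrow> p - z \<in> U \<Longrightarrow> q - z \<in> U \<Longrightarrow> p = q"
    by (rule uniformly_discreteE[OF discrete]) blast
  \<comment> \<open>The bump is evaluated at \<open>x - y\<close>, whereas separation concerns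
    \<open>y - x\<close>; hence the reflection.\<close>
  let ?V = "uminus -` U"
  have V: "open ?V" "0 \<in> ?V" using U(1,2) by (auto intro!: open_vimage continuous_intros)
  obtain \<phi> :: "'g \<Rightarrow> real" where \<phi>: "\<phi> \<in> Cc" "range \<phi> \<subseteq> {0..1}" "\<phi> 0 = 1" "\<And>y. y \<notin> ?V \<Longrightarrow> \<phi> y = 0"
    by (rule bump_exists[OF lc V]) blast
  obtain K where K: "compact K" "\<And>x. \<phi> x \<noteq> 0 \<Longrightarrow> x \<in> K" using Cc_support[OF \<phi>(1)] by blast
  let ?g = "\<lambda>y. of_real (\<phi> y) :: complex"
  have g: "?g \<in> Cc" by (rule Cc_of_real[OF \<phi>(1)])
  have at: "convolve_measure \<mu> ?g x = (\<Sum>y\<in>F. a y * ?g (x - y))"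
    if "finite F" "\<And>y. y \<in> \<Lambda> \<Longrightarrow> y - x \<in> U \<Longrightarrow> y \<in> F" for x F
    unfolding convolve_measure_def
  proof (rule eval)
    fix y assume "y \<in> \<Lambda>" "?g (x - y) \<noteq> 0"
    with \<phi>(4)[of "x - y"] have "y - x \<in> U" by auto
    with that(2) \<open>y \<in> \<Lambda>\<close> show "y \<in> F" .
  next
    show "(\<lambda>y. ?g (x - y)) \<in> Cc" by (rule Cc_reflect[OF g])
    show "finite F" by (rule that(1))
  qed
  have at_0: "convolve_measure \<mu> ?g 0 = of_real r"
    using at[of "{0}" 0] U(3)[OF _ 0, of _ 0] U(2) a0 \<phi>(3) by auto
  let ?d = "\<lambda>t x. ennreal (norm (convolve_measure \<mu> ?g x - translate t (convolve_measure \<mu> ?g) x))"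
  have "bohr_almost_periodic (convolve_measure \<mu> ?g)"
    using ap g by (simp add: strongly_almost_periodic_def)
  then have "relatively_dense {t. (SUP x. ?d t x) < ennreal e'}"
    using e'(1) by (simp add: bohr_almost_periodic_def)
  moreover have "\<exists>b\<in>{x \<in> \<Lambda>. r - e \<le> Re (a x)}. t - b \<in> K" if t: "t \<in> {t. (SUP x. ?d t x) < ennreal e'}" for t
  proof -
    \<comment> \<open>Taking \<open>x = t\<close> compares the value at \<open>t\<close> with the
      value at 0.\<close>
    have "?d t t \<le> (SUP x. ?d t x)" by (rule SUP_upper) simp
    also have "\<dots> < ennreal e'" using t by (simp only: mem_Collect_eq)
    finally have "?d t t < ennreal e'" .
    then have close: "norm (convolve_measure \<mu> ?g t - of_real r) < e'"
      using at_0 by (simp add: translate_def ennreal_less_iff)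
    have "\<exists>y\<in>\<Lambda>. y - t \<in> U"
    proof (rule ccontr)
      assume "\<not> ?thesis"
      then have "convolve_measure \<mu> ?g t = 0" using at[of "{}" t] by auto
      with close e'(3) a0(2) show False by simp
    qed
    then obtain y where y: "y \<in> \<Lambda>" "y - t \<in> U" by blast
    have "convolve_measure \<mu> ?g t = a y * ?g (t - y)"
      using at[of "{y}" t] U(3)[OF _ y(1) _ y(2)] by auto
    with close have "\<bar>Re (a y) * \<phi> (t - y) - r\<bar> < e'"
      using abs_Re_le_cmod[of "a y * ?g (t - y) - of_real r"] by simp
    then have lower: "r - e' < Re (a y) * \<phi> (t - y)" by linarith
    have rng: "0 \<le> \<phi> (t - y)" "\<phi> (t - y) \<le> 1" using \<phi>(2) by (auto simp: image_subset_iff)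
    have pos: "0 < Re (a y) * \<phi> (t - y)" using lower e'(3) by linarith
    then have "0 < Re (a y)" "\<phi> (t - y) \<noteq> 0" using rng by (auto simp: zero_less_mult_iff)
    moreover have "Re (a y) * \<phi> (t - y) \<le> Re (a y) * 1"
      using rng \<open>0 < Re (a y)\<close> by (intro mult_left_mono) auto
    then have "r - e \<le> Re (a y)" using lower e'(2) by linarith
    ultimately show ?thesis using y(1) K(2)[of "t - y"] by blast
  qed
  ultimately show ?thesis using relatively_dense_cover[OF _ K(1)] by blast
qed

section \<open>Completion of a group in an invariant metric\<close>

text \<open>Open sets are the subsets of the image with open preimage. This supplies the topology on
  the coset space that \<open>cocompact_in\<close> asks for.\<close>

lemma quotient_topology_exists:
  obtains Q where "topspace Q = f ` topspace X" "quotient_map X Q f"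
proof -
  define Q where "Q = topology (\<lambda>V. V \<subseteq> f ` topspace X \<and> openin X {x \<in> topspace X. f x \<in> V})"
  have "istopology (\<lambda>V. V \<subseteq> f ` topspace X \<and> openin X {x \<in> topspace X. f x \<in> V})"
    unfolding istopology_def
  proof (intro conjI allI impI)
    fix S T
    assume "S \<subseteq> f ` topspace X \<and> openin X {x \<in> topspace X. f x \<in> S}"
      and "T \<subseteq> f ` topspace X \<and> openin X {x \<in> topspace X. f x \<in> T}"
    moreover have "{x \<in> topspace X. f x \<in> S \<inter> T} =
        {x \<in> topspace X. f x \<in> S} \<inter> {x \<in> topspace X. f x \<in> T}" by auto
    ultimately show "S \<inter> T \<subseteq> f ` topspace X" "openin X {x \<in> topspace X. f x \<in> S \<inter> T}"
      by auto
  next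
    fix \<K>
    assume K: "\<forall>V\<in>\<K>. V \<subseteq> f ` topspace X \<and> openin X {x \<in> topspace X. f x \<in> V}"
    then show "\<Union>\<K> \<subseteq> f ` topspace X" by blast
    have "{x \<in> topspace X. f x \<in> \<Union>\<K>} = (\<Union>V\<in>\<K>. {x \<in> topspace X. f x \<in> V})" by auto
    with K show "openin X {x \<in> topspace X. f x \<in> \<Union>\<K>}" by auto
  qed
  then have op: "openin Q V \<longleftrightarrow> V \<subseteq> f ` topspace X \<and> openin X {x \<in> topspace X. f x \<in> V}" for V
    by (simp add: Q_def)
  have "{x \<in> topspace X. f x \<in> f ` topspace X} = topspace X" by auto
  then have "openin Q (f ` topspace X)" by (simp add: op)
  then have ts: "topspace Q = f ` topspace X"
    by (metis op openin_subset openin_topspace subset_antisym)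
  then have "quotient_map X Q f"
    by (auto simp: quotient_map_def op)
  with ts show thesis by (rule that)
qed

text \<open>Every coset meets \<open>C\<close>, so the quotient is the continuous image of a compact
  set.\<close>

lemma cocompact_inI:
  assumes "group G" "subgroup L G" "topspace X = carrier G" "compactin X C"
    and cov: "\<And>x. x \<in> carrier G \<Longrightarrow> \<exists>l\<in>L. \<exists>c\<in>C. x = l \<otimes>\<^bsub>G\<^esub> c"
  shows "cocompact_in L G X"
proof -
  let ?f = "\<lambda>x. L #>\<^bsub>G\<^esub> x"
  obtain Q where Q: "topspace Q = ?f ` topspace X" "quotient_map X Q ?f"
    by (rule quotient_topology_exists)
  have C: "C \<subseteq> carrier G"
    using assms(3,4) compactin_subset_topspace by metis
  have "?f x \<in> ?f ` C" if x: "x \<in> carrier G" for x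
  proof -
    obtain l c where lc: "l \<in> L" "c \<in> C" "x = l \<otimes>\<^bsub>G\<^esub> c" using cov[OF x] by blast
    then have "x \<in> L #>\<^bsub>G\<^esub> c" by (auto simp: r_coset_def)
    then have "?f c = ?f x"
      by (rule group.repr_independence[OF assms(1)]) (use lc C assms(2) in auto)
    with lc(2) show ?thesis by (metis imageI)
  qed
  then have "?f ` C = topspace Q" using C assms(3) Q(1) by auto
  moreover have "compactin Q (?f ` C)"
    using image_compactin[OF assms(4) quotient_imp_continuous_map[OF Q(2)]] .
  ultimately have "compact_space Q" by (simp add: compact_space_def)
  moreover have "topspace Q = rcosets\<^bsub>G\<^esub> L"
    using Q(1) assms(3) by (auto simp: RCOSETS_def)
  ultimately show ?thesis
    using Q(2) by (auto simp: cocompact_in_def)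
qed

section \<open>Extension of the group operations to the closure of an orbit\<close>

text \<open>The orbit map \<open>u\<close> is not assumed injective (periods are allowed);
  translation invariance of \<open>d\<close> is what makes addition of parameters well defined on
  the orbit.\<close>

locale dense_orbit = Metric_space M d for M :: "'a set" and d +
  fixes u :: "'g::ab_group_add \<Rightarrow> 'a"
  assumes u_in [simp]: "u s \<in> M"
    and d_u_add: "d (u (s + x)) (u (t + x)) = d (u s) (u t)"
    and dense: "v \<in> M \<Longrightarrow> 0 < e \<Longrightarrow> \<exists>s. d (u s) v < e"
    and complete: mcomplete
begin

text \<open>The factor \<open>C\<close> lets identities be proved with several accumulated errors,
  without dividing \<open>e\<close> beforehand.\<close>

lemma d_eqI:
  assumes "v \<in> M" "w \<in> M" "\<And>e. 0 < e \<Longrightarrow> d v w \<le> C * e" "0 \<le> C"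
  shows "v = w"
proof (rule ccontr)
  assume "v \<noteq> w"
  then have p: "0 < d v w" using assms by simp
  \<comment> \<open>The denominator uses \<open>C + 1\<close> because \<open>C\<close> may be
    0.\<close>
  have "0 < d v w / (2 * (C + 1))" using p assms(4) by simp
  then have "d v w \<le> C * (d v w / (2 * (C + 1)))" by (rule assms(3))
  also have "\<dots> \<le> (C + 1) * (d v w / (2 * (C + 1)))"
    using p assms by (intro mult_right_mono) auto
  also have "\<dots> = d v w / 2" using assms(4) by (auto simp: field_simps add_eq_0_iff)
  finally show False using p by simp
qed

text \<open>Points with \<open>r\<close> tending to 0 along a sequence of indices form a Cauchy
  sequence, and passing to the limit gives the estimate for every index. Maps are extended from the
  orbit this way, with \<open>r\<close> measuring how well an index approximates the
  argument.\<close>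

lemma limit_exists:
  fixes p :: "'i \<Rightarrow> 'a" and r :: "'i \<Rightarrow> real"
  assumes p: "\<And>i. p i \<in> M" and r: "\<And>e. 0 < e \<Longrightarrow> \<exists>i. r i < e"
    and d: "\<And>i j. d (p i) (p j) \<le> r i + r j"
  shows "\<exists>z\<in>M. \<forall>i. d (p i) z \<le> r i"
proof -
  have "\<forall>n. \<exists>i. r i < inverse (real (Suc n))" by (intro allI r) simp
  then obtain i where i: "\<And>n. r (i n) < inverse (real (Suc n))" by metis
  have sm: "\<exists>N. \<forall>n\<ge>N. r (i n) < e" if e: "0 < e" for e
  proof -
    obtain N where N: "inverse (real (Suc N)) < e" using reals_Archimedean[OF e] by auto
    have "r (i n) < e" if "n \<ge> N" for n
    proof -
      have "inverse (real (Suc n)) \<le> inverse (real (Suc N))" using that by simp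
      with i[of n] N show ?thesis by linarith
    qed
    then show ?thesis by blast
  qed
  have "MCauchy (\<lambda>n. p (i n))"
    unfolding MCauchy_def
  proof (intro conjI allI impI)
    show "range (\<lambda>n. p (i n)) \<subseteq> M" using p by auto
    fix e :: real assume "0 < e"
    then obtain N where N: "\<And>n. n \<ge> N \<Longrightarrow> r (i n) < e / 2" using sm[of "e/2"] by auto
    have "d (p (i n)) (p (i n')) < e" if "n \<ge> N" "n' \<ge> N" for n n'
      using N[OF that(1)] N[OF that(2)] d[of "i n" "i n'"] by linarith
    then show "\<exists>N. \<forall>n n'. N \<le> n \<longrightarrow> N \<le> n' \<longrightarrow> d (p (i n)) (p (i n')) < e" by blast
  qed
  then obtain z where z: "limitin mtopology (\<lambda>n. p (i n)) z sequentially"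
    using complete unfolding mcomplete_def by blast
  then have zM: "z \<in> M" and zl: "\<And>e. 0 < e \<Longrightarrow> \<exists>N. \<forall>n\<ge>N. d (p (i n)) z < e"
    unfolding limit_metric_sequentially by blast+
  have "d (p j) z \<le> r j" for j
  proof (rule field_le_epsilon)
    fix e :: real assume "0 < e"
    then obtain N N' where N: "\<And>n. n \<ge> N \<Longrightarrow> r (i n) < e / 2"
      and N': "\<And>n. n \<ge> N' \<Longrightarrow> d (p (i n)) z < e / 2"
      using sm[of "e/2"] zl[of "e/2"] by auto
    let ?n = "max N N'"
    have "d (p j) z \<le> d (p j) (p (i ?n)) + d (p (i ?n)) z" using p zM by (intro triangle) auto
    with d[of j "i ?n"] N[of ?n] N'[of ?n] show "d (p j) z \<le> r j + e" by auto
  qed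
  with zM show ?thesis by blast
qed

text \<open>The estimate determines \<open>z\<close> uniquely for \<open>v\<close> and
  \<open>w\<close> in \<open>M\<close>, as its right-hand side becomes arbitrarily small by density.
  No approximating sequences have to be chosen.\<close>

definition mul :: "'a \<Rightarrow> 'a \<Rightarrow> 'a" where
  "mul v w = (SOME z. z \<in> M \<and> (\<forall>s t. d (u (s + t)) z \<le> d (u s) v + d (u t) w))"

definition neg :: "'a \<Rightarrow> 'a" where
  "neg v = (SOME z. z \<in> M \<and> (\<forall>s. d (u (- s)) z \<le> d (u s) v))"

lemma d_u_diff: "d (u s) (u t) = d (u (s - t)) (u 0)"
  using d_u_add[of "s - t" t 0] by simp

lemma d_u_add2: "d (u (s + t)) (u (s' + t')) \<le> d (u s) (u s') + d (u t) (u t')"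
proof -
  have "d (u (s + t)) (u (s' + t')) \<le> d (u (s + t)) (u (s' + t)) + d (u (s' + t)) (u (s' + t'))"
    by (intro triangle) auto
  also have "\<dots> = d (u s) (u s') + d (u t) (u t')"
    using d_u_add[of s t s'] d_u_add[of t s' t'] by (simp add: add.commute)
  finally show ?thesis .
qed

text \<open>Translation by \<open>s + t\<close> turns \<open>- s\<close> and \<open>- t\<close> into
  \<open>t\<close> and \<open>s\<close>.\<close>

lemma d_u_minus: "d (u (- s)) (u (- t)) = d (u s) (u t)"
  using d_u_add[of "- s" "s + t" "- t"] by (simp add: commute)

text \<open>Apply \<open>limit_exists\<close> with pairs of parameters as indices; its compatibility
  condition is \<open>d_u_add2\<close> with the triangle inequality.\<close>

lemma mul: 
  assumes "v \<in> M" "w \<in> M"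
  shows mul_in [simp]: "mul v w \<in> M" and d_mul: "d (u (s + t)) (mul v w) \<le> d (u s) v + d (u t) w"
proof -
  have "\<exists>z\<in>M. \<forall>i. d (u (fst i + snd i)) z \<le> d (u (fst i)) v + d (u (snd i)) w"
  proof (rule limit_exists)
    fix e :: real assume "0 < e"
    then obtain s t where "d (u s) v < e / 2" "d (u t) w < e / 2"
      using dense[of v "e/2"] dense[of w "e/2"] assms by auto
    then show "\<exists>i. d (u (fst i)) v + d (u (snd i)) w < e"
      by (intro exI[of _ "(s, t)"]) auto
  next
    fix i j
    have "d (u (fst i)) (u (fst j)) \<le> d (u (fst i)) v + d (u (fst j)) v"
      "d (u (snd i)) (u (snd j)) \<le> d (u (snd i)) w + d (u (snd j)) w"
      using assms by (auto intro!: triangle')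
    with d_u_add2[of "fst i" "snd i" "fst j" "snd j"]
    show "d (u (fst i + snd i)) (u (fst j + snd j))
        \<le> d (u (fst i)) v + d (u (snd i)) w + (d (u (fst j)) v + d (u (snd j)) w)"
      by linarith
  qed auto
  then have "\<exists>z. z \<in> M \<and> (\<forall>s t. d (u (s + t)) z \<le> d (u s) v + d (u t) w)" by auto
  from someI_ex[OF this]
  show "mul v w \<in> M" "d (u (s + t)) (mul v w) \<le> d (u s) v + d (u t) w"
    unfolding mul_def by auto
qed

lemma neg: 
  assumes "v \<in> M"
  shows neg_in [simp]: "neg v \<in> M" and d_neg: "d (u (- s)) (neg v) \<le> d (u s) v"
proof -
  have "\<exists>z\<in>M. \<forall>s. d (u (- s)) z \<le> d (u s) v"
  proof (rule limit_exists)
    show "d (u (- s)) (u (- t)) \<le> d (u s) v + d (u t) v" for s t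
      using assms by (auto simp: d_u_minus intro!: triangle')
  qed (use assms dense in auto)
  then have "\<exists>z. z \<in> M \<and> (\<forall>s. d (u (- s)) z \<le> d (u s) v)" by auto
  from someI_ex[OF this]
  show "neg v \<in> M" "d (u (- s)) (neg v) \<le> d (u s) v"
    unfolding neg_def by auto
qed

lemma mul_nonexpansive:
  assumes "v \<in> M" "w \<in> M" "v' \<in> M" "w' \<in> M"
  shows "d (mul v w) (mul v' w') \<le> d v v' + d w w'"
proof (rule field_le_epsilon)
  fix e :: real assume "0 < e"
  \<comment> \<open>Each of the four approximations enters twice.\<close>
  then have e: "0 < e / 8" by simp
  obtain s t s' t' where a: "d (u s) v < e / 8" "d (u t) w < e / 8"
      "d (u s') v' < e / 8" "d (u t') w' < e / 8"
    using dense[OF _ e] assms by meson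
  have "d (mul v w) (mul v' w')
      \<le> d (mul v w) (u (s + t)) + (d (u (s + t)) (u (s' + t')) + d (u (s' + t')) (mul v' w'))"
    using assms by (meson u_in mul_in triangle add_left_mono order_trans)
  moreover have "d (u s) (u s') \<le> d (u s) v + (d v v' + d v' (u s'))"
    using assms by (meson u_in triangle add_left_mono order_trans)
  moreover have "d (u t) (u t') \<le> d (u t) w + (d w w' + d w' (u t'))"
    using assms by (meson u_in triangle add_left_mono order_trans)
  moreover note d_mul[OF assms(1,2), of s t] d_mul[OF assms(3,4), of s' t']
    d_u_add2[of s t s' t']
  moreover have "d (mul v w) (u (s + t)) = d (u (s + t)) (mul v w)"
    "d v' (u s') = d (u s') v'" "d w' (u t') = d (u t') w'" by (simp_all add: commute)
  ultimately show "d (mul v w) (mul v' w') \<le> d v v' + d w w' + e"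
    using a by linarith
qed

lemma neg_nonexpansive:
  assumes "v \<in> M" "v' \<in> M"
  shows "d (neg v) (neg v') \<le> d v v'"
proof (rule field_le_epsilon)
  fix e :: real assume "0 < e"
  then have e: "0 < e / 4" by simp
  obtain s s' where a: "d (u s) v < e / 4" "d (u s') v' < e / 4"
    using dense[OF _ e] assms by meson
  have "d (neg v) (neg v') \<le> d (neg v) (u (- s)) + (d (u (- s)) (u (- s')) + d (u (- s')) (neg v'))"
    using assms by (meson u_in neg_in triangle add_left_mono order_trans)
  moreover have "d (u s) (u s') \<le> d (u s) v + (d v v' + d v' (u s'))"
    using assms by (meson u_in triangle add_left_mono order_trans)
  moreover have "d (neg v) (u (- s)) = d (u (- s)) (neg v)" "d v' (u s') = d (u s') v'"
    by (simp_all add: commute)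
  ultimately show "d (neg v) (neg v') \<le> d v v' + e"
    using a d_neg[OF assms(1), of s] d_neg[OF assms(2), of s'] d_u_minus[of s s'] by linarith
qed

lemma mul_u [simp]: "mul (u s) (u t) = u (s + t)"
  using d_mul[of "u s" "u t" s t] by (simp add: zero[symmetric] commute order_antisym)

lemma neg_u [simp]: "neg (u s) = u (- s)"
  using d_neg[of "u s" s] by (simp add: zero[symmetric] commute order_antisym)

text \<open>Both sides lie within \<open>2 * e\<close> of the orbit point \<open>u (s + t)\<close>.
  The other group laws pass from the parameters to \<open>M\<close> in the same way.\<close>

lemma mul_commute:
  assumes "v \<in> M" "w \<in> M"
  shows "mul v w = mul w v"
proof (rule d_eqI[where C = 4])
  fix e :: real assume e: "0 < e"
  obtain s t where a: "d (u s) v < e" "d (u t) w < e"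
    using dense[OF _ e] assms by meson
  have "d (mul v w) (mul w v) \<le> d (u (s + t)) (mul v w) + d (u (s + t)) (mul w v)"
    using assms by (auto intro: triangle'')
  with a d_mul[OF assms, of s t] d_mul[OF assms(2,1), of t s]
  show "d (mul v w) (mul w v) \<le> 4 * e" by (simp add: add.commute[of t])
qed (use assms in auto)

lemma mul_assoc:
  assumes "v \<in> M" "w \<in> M" "z \<in> M"
  shows "mul (mul v w) z = mul v (mul w z)"
proof (rule d_eqI[where C = 6])
  fix e :: real assume e: "0 < e"
  obtain s t x where a: "d (u s) v < e" "d (u t) w < e" "d (u x) z < e"
    using dense[OF _ e] assms by meson
  have "d (mul (mul v w) z) (mul v (mul w z))
      \<le> d (u (s + t + x)) (mul (mul v w) z) + d (u (s + t + x)) (mul v (mul w z))"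
    using assms by (auto intro: triangle'')
  with a d_mul[of v w s t] d_mul[of w z t x] d_mul[of "mul v w" z "s + t" x]
    d_mul[of v "mul w z" s "t + x"] assms
  show "d (mul (mul v w) z) (mul v (mul w z)) \<le> 6 * e" by (simp add: add.assoc)
qed (use assms in auto)

lemma mul_zero:
  assumes "v \<in> M"
  shows "mul (u 0) v = v"
proof (rule d_eqI[where C = 2])
  fix e :: real assume e: "0 < e"
  obtain s where a: "d (u s) v < e" using dense[OF assms e] by auto
  have "d (mul (u 0) v) v \<le> d (u s) (mul (u 0) v) + d (u s) v"
    using assms by (auto intro: triangle'')
  with a d_mul[of "u 0" v 0 s] assms show "d (mul (u 0) v) v \<le> 2 * e" by simp
qed (use assms in auto)

lemma mul_neg:
  assumes "v \<in> M"
  shows "mul (neg v) v = u 0"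
proof (rule d_eqI[where C = 2])
  fix e :: real assume e: "0 < e"
  obtain s where a: "d (u s) v < e" using dense[OF assms e] by auto
  show "d (mul (neg v) v) (u 0) \<le> 2 * e"
    using a d_mul[of "neg v" v "-s" s] d_neg[OF assms, of s] assms by (simp add: commute)
qed (use assms in auto)

definition grp :: "'a monoid" where
  "grp = \<lparr>carrier = M, monoid.mult = mul, one = u 0\<rparr>"

lemma grp_simps [simp]: "carrier grp = M" "monoid.mult grp = mul" "one grp = u 0"
  by (simp_all add: grp_def)

lemma comm_group_grp: "comm_group grp"
proof (rule comm_groupI)
  show "\<exists>y\<in>carrier grp. y \<otimes>\<^bsub>grp\<^esub> v = \<one>\<^bsub>grp\<^esub>" if "v \<in> carrier grp" for v
    using that by (intro bexI[of _ "neg v"]) (auto simp: mul_neg)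
qed (auto simp: mul_assoc mul_zero intro: mul_commute)

lemma inv_grp: "v \<in> M \<Longrightarrow> inv\<^bsub>grp\<^esub> v = neg v"
  using comm_group_grp by (intro group.inv_equality) (auto simp: comm_group_def mul_neg)

text \<open>Multiplication by \<open>z\<close> and its inverse, multiplication by
  \<open>neg z\<close>, are both nonexpansive.\<close>

lemma d_mul_cancel:
  assumes "v \<in> M" "w \<in> M" "z \<in> M"
  shows "d (mul z v) (mul z w) = d v w"
proof (rule antisym)
  show "d (mul z v) (mul z w) \<le> d v w" using mul_nonexpansive[of z v z w] assms by simp
  have "mul (neg z) (mul z x) = x" if "x \<in> M" for x
    using assms that by (simp add: mul_assoc[symmetric] mul_neg mul_zero)
  then show "d v w \<le> d (mul z v) (mul z w)"
    using mul_nonexpansive[of "neg z" "mul z v" "neg z" "mul z w"] assms by simp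
qed

lemma continuous_mul:
  "continuous_map (prod_topology mtopology mtopology) mtopology (\<lambda>(x, y). mul x y)"
  unfolding continuous_map_to_metric
proof (intro ballI allI impI)
  fix p and e :: real
  assume p: "p \<in> topspace (prod_topology mtopology mtopology)" and e: "0 < e"
  obtain v w where vw: "p = (v, w)" "v \<in> M" "w \<in> M" using p by auto
  show "\<exists>U. openin (prod_topology mtopology mtopology) U \<and> p \<in> U \<and>
      (\<forall>y\<in>U. (case y of (x, y) \<Rightarrow> mul x y) \<in> mball (case p of (x, y) \<Rightarrow> mul x y) e)"
  proof (intro exI[of _ "mball v (e/2) \<times> mball w (e/2)"] conjI ballI)
    show "p \<in> mball v (e/2) \<times> mball w (e/2)" using vw e by auto
    fix y assume "y \<in> mball v (e/2) \<times> mball w (e/2)"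
    then show "(case y of (x, y) \<Rightarrow> mul x y) \<in> mball (case p of (x, y) \<Rightarrow> mul x y) e"
      using vw mul_nonexpansive[of v w "fst y" "snd y"] by (auto split: prod.splits)
  qed (auto simp: openin_prod_Times_iff)
qed

lemma continuous_neg: "continuous_map mtopology mtopology neg"
  unfolding continuous_map_to_metric
proof (intro ballI allI impI)
  fix v and e :: real
  assume "v \<in> topspace mtopology" "0 < e"
  then show "\<exists>U. openin mtopology U \<and> v \<in> U \<and> (\<forall>y\<in>U. neg y \<in> mball (neg v) e)"
    by (intro exI[of _ "mball v e"]) (auto intro: order.strict_trans1[OF neg_nonexpansive])
qed

lemma lca_groupI: "locally_compact_space mtopology \<Longrightarrow> lca_group grp mtopology"
  unfolding lca_group_def
  using comm_group_grp continuous_mul continuous_map_eq[OF continuous_neg, of "\<lambda>x. inv\<^bsub>grp\<^esub> x"]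
  by (auto simp: inv_grp Hausdorff_space_mtopology)

text \<open>In a complete metric space the closure of a totally bounded set is compact. The premise
  allows net points with parameters outside \<open>A\<close>.\<close>

lemma compact_closure:
  assumes "\<And>e. 0 < e \<Longrightarrow> \<exists>F. finite F \<and> (\<forall>t\<in>A. \<exists>f\<in>F. d (u t) (u f) < e)"
  shows "compactin mtopology (mtopology closure_of (u ` A))"
proof -
  have "mtotally_bounded (u ` A)"
    unfolding mtotally_bounded_def
  proof (intro allI impI)
    fix e :: real assume "0 < e"
    then obtain F where F: "finite F" "\<And>t. t \<in> A \<Longrightarrow> \<exists>f\<in>F. d (u t) (u f) < e / 2"
      using assms[of "e/2"] by auto
    define F' where "F' = {f \<in> F. \<exists>t\<in>A. d (u t) (u f) < e / 2}"
    then have "\<forall>f\<in>F'. \<exists>t\<in>A. d (u t) (u f) < e / 2" by auto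
    then obtain c where c: "\<And>f. f \<in> F' \<Longrightarrow> c f \<in> A \<and> d (u (c f)) (u f) < e / 2" by metis
    have fin: "finite F'" using F by (auto simp: F'_def)
    have "\<exists>f\<in>F'. d (u (c f)) (u t) < e" if t: "t \<in> A" for t
    proof -
      obtain f where f: "f \<in> F" "d (u t) (u f) < e / 2" using F(2)[OF t] by blast
      then have "f \<in> F'" using t by (auto simp: F'_def)
      moreover have "d (u (c f)) (u t) \<le> d (u (c f)) (u f) + d (u t) (u f)"
        by (intro triangle') auto
      ultimately show ?thesis using f(2) c[of f] by force
    qed
    then have "u ` A \<subseteq> (\<Union>x\<in>u ` c ` F'. mball x e)" by fastforce
    moreover have "u ` c ` F' \<subseteq> u ` A" using c by auto
    ultimately show "\<exists>K. finite K \<and> K \<subseteq> u ` A \<and> u ` A \<subseteq> (\<Union>x\<in>K. mball x e)"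
      using fin by (intro exI[of _ "u ` c ` F'"]) auto
  qed
  then show ?thesis using mtotally_bounded_eq_compact_closure_of[OF complete] by blast
qed

end

section \<open>The ambient group in explicit-carrier form\<close>

lemma comm_group_additive: "comm_group (additive_group :: 'g::ab_group_add monoid)"
  by (rule comm_groupI) (auto simp: additive_group_def add.assoc add.commute intro: exI[of _ "- x" for x])

lemma additive_simps [simp]: "carrier additive_group = UNIV" "monoid.mult additive_group = (+)"
  "one additive_group = 0"
  by (simp_all add: additive_group_def)

lemma inv_additive [simp]: "inv\<^bsub>additive_group\<^esub> x = - (x :: 'g::ab_group_add)"
  using comm_group_additive by (intro group.inv_equality) (auto simp: comm_group_def)

lemma lca_additive:
  assumes "locally_compact_space (euclidean :: 'g::{topological_ab_group_add, t2_space} topology)"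
  shows "lca_group (additive_group :: 'g monoid) euclidean"
  unfolding lca_group_def
proof (intro conjI)
  have "continuous_on UNIV (\<lambda>(x, y). x + y :: 'g)"
    by (auto simp: split_beta intro!: continuous_intros)
  then show "continuous_map (prod_topology euclidean euclidean) (euclidean :: 'g topology)
      (\<lambda>(x, y). x \<otimes>\<^bsub>additive_group\<^esub> y)"
    by (simp add: euclidean_product_topology)
  have "continuous_on UNIV (uminus :: 'g \<Rightarrow> 'g)" by (intro continuous_intros)
  then show "continuous_map euclidean (euclidean :: 'g topology) (\<lambda>x. inv\<^bsub>additive_group\<^esub> x)" by simp
  show "Hausdorff_space (euclidean :: 'g topology)"
    using hausdorff by (auto simp: Hausdorff_space_def disjnt_def)
qed (use assms comm_group_additive in auto)


section \<open>The cut and project scheme\<close>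

text \<open>The value \<open>h (u t)\<close> stands for the weight at \<open>t\<close>. The last two
  assumptions record what uniform discreteness of the support contributes.\<close>

locale almost_periodic_orbit = dense_orbit M d u
  for M :: "'a set" and d and u :: "'g::{topological_ab_group_add, t2_space} \<Rightarrow> 'a" +
  fixes h :: "'a \<Rightarrow> complex"
  assumes lc: "locally_compact_space (euclidean :: 'g topology)"
    and h_lipschitz: "v \<in> M \<Longrightarrow> w \<in> M \<Longrightarrow> norm (h v - h w) \<le> d v w"
    and h_nz: "h (u 0) \<noteq> 0"
    and almost_periods: "0 < e \<Longrightarrow> relatively_dense {t. d (u t) (u 0) < e}"
    and finite_supp: "compact K \<Longrightarrow> finite {t \<in> K. h (u t) \<noteq> 0}"
    and isolated: "\<exists>U. open U \<and> 0 \<in> U \<and> (\<forall>t\<in>U. h (u t) \<noteq> 0 \<longrightarrow> t = 0)"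
begin

lemma almost_period_obtain:
  assumes "0 < e"
  obtains K where "compact K" "\<And>t. \<exists>s k. k \<in> K \<and> t = s + k \<and> d (u s) (u 0) < e"
proof -
  obtain K where K: "compact K" "{x + k |x k. x \<in> {t. d (u t) (u 0) < e} \<and> k \<in> K} = UNIV"
    using almost_periods[OF assms] unfolding relatively_dense_def by blast
  have "\<exists>s k. k \<in> K \<and> t = s + k \<and> d (u s) (u 0) < e" for t
    using UNIV_I[of t] unfolding K(2)[symmetric] by auto
  with K(1) show thesis by (rule that)
qed

lemma d_u_shift: "d (u (s + k)) (u k) = d (u s) (u 0)"
  using d_u_add[of s k 0] by simp

section \<open>Local compactness of the internal group\<close>

text \<open>Write \<open>t = s + k\<close> with an almost period \<open>s\<close> and
  \<open>k\<close> in a compact set. Then \<open>u t\<close> is close to \<open>u k\<close>, and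
  only finitely many \<open>k\<close> with nonzero weight occur.\<close>

lemma compact_large:
  assumes "0 < e"
  shows "compactin mtopology (mtopology closure_of (u ` {t. e \<le> norm (h (u t))}))"
proof (rule compact_closure)
  fix b :: real assume b: "0 < b"
  \<comment> \<open>The bound by \<open>b\<close> makes \<open>u k\<close> close enough for the net;
    the bound by \<open>e\<close> keeps \<open>h (u k)\<close> from vanishing.\<close>
  define c where "c = min b e"
  have c: "0 < c" "c \<le> b" "c \<le> e" using b assms by (auto simp: c_def)
  obtain K where K: "compact K" "\<And>t. \<exists>s k. k \<in> K \<and> t = s + k \<and> d (u s) (u 0) < c"
    by (rule almost_period_obtain[OF c(1)]) blast
  have "\<exists>k\<in>{k \<in> K. h (u k) \<noteq> 0}. d (u t) (u k) < b" if t: "e \<le> norm (h (u t))" for t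
  proof -
    obtain s k where sk: "k \<in> K" "t = s + k" "d (u s) (u 0) < c" using K(2) by blast
    then have d: "d (u t) (u k) < c" by (simp add: d_u_shift)
    have "norm (h (u t) - h (u k)) < e" using h_lipschitz[of "u t" "u k"] d c by simp
    with t have "h (u k) \<noteq> 0" by auto
    with sk d c show ?thesis by (intro bexI[of _ k]) auto
  qed
  with finite_supp[OF K(1)]
  show "\<exists>F. finite F \<and> (\<forall>t\<in>{t. e \<le> norm (h (u t))}. \<exists>f\<in>F. d (u t) (u f) < b)"
    by (intro exI[of _ "{k \<in> K. h (u k) \<noteq> 0}"]) auto
qed

text \<open>By the Lipschitz bound the norm of \<open>h\<close> is at least \<open>radius\<close> on
  the closed ball of this radius about \<open>u 0\<close>.\<close>

definition "radius = norm (h (u 0)) / 2"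

lemma radius_pos: "0 < radius" using h_nz by (simp add: radius_def)

text \<open>Orbit points within \<open>radius / 2\<close> of a point of this ball are within
  \<open>radius\<close> of \<open>u 0\<close>, hence have large weight. So the ball lies in a
  compact closure.\<close>

lemma compact_mcball_zero: "compactin mtopology (mcball (u 0) (radius / 2))"
proof (rule closed_compactin)
  let ?A = "{t. radius \<le> norm (h (u t))}"
  show "compactin mtopology (mtopology closure_of (u ` ?A))"
    using compact_large radius_pos by blast
  show "mcball (u 0) (radius / 2) \<subseteq> mtopology closure_of (u ` ?A)"
  proof
    fix v assume v: "v \<in> mcball (u 0) (radius / 2)"
    have "\<exists>y\<in>u ` ?A. y \<in> mball v r" if r: "0 < r" for r
    proof -
      obtain s where s: "d (u s) v < min r (radius / 2)"
        using dense[of v "min r (radius / 2)"] v r radius_pos by auto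
      have "d (u s) (u 0) \<le> d (u s) v + d v (u 0)" using v by (intro triangle) auto
      then have "d (u s) (u 0) \<le> radius" using s v by (simp add: commute)
      with h_lipschitz[of "u s" "u 0"] have "norm (h (u s) - h (u 0)) \<le> radius" by simp
      then have "radius \<le> norm (h (u s))"
        using norm_triangle_ineq2[of "h (u 0)" "h (u s)"]
        by (simp add: radius_def norm_minus_commute)
      with s v show ?thesis by (auto simp: commute)
    qed
    with v show "v \<in> mtopology closure_of (u ` ?A)"
      by (auto simp: metric_closure_of)
  qed
qed simp

text \<open>Multiplication by \<open>v\<close> is an isometry that carries the compact ball about
  \<open>u 0\<close> to a compact neighbourhood of \<open>v\<close>.\<close>

lemma locally_compact: "locally_compact_space mtopology"
  unfolding locally_compact_space_def
proof
  fix v assume "v \<in> topspace mtopology"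
  then have v: "v \<in> M" by simp
  have cont: "continuous_map mtopology mtopology (mul v)"
    unfolding continuous_map_to_metric
  proof (intro ballI allI impI)
    fix w and e :: real assume "w \<in> topspace mtopology" "0 < e"
    then show "\<exists>U. openin mtopology U \<and> w \<in> U \<and> (\<forall>y\<in>U. mul v y \<in> mball (mul v w) e)"
      using v by (intro exI[of _ "mball w e"]) (auto simp: d_mul_cancel)
  qed
  have "w \<in> mul v ` mcball (u 0) (radius / 2)" if w: "w \<in> mball v (radius / 2)" for w
  proof
    show "w = mul v (mul (neg v) w)"
      using v w by (simp add: mul_assoc[symmetric] mul_commute[of v "neg v"] mul_neg mul_zero)
    have "d (u 0) (mul (neg v) w) = d v w"
      using v w d_mul_cancel[of v w "neg v"] by (simp add: mul_neg)
    then show "mul (neg v) w \<in> mcball (u 0) (radius / 2)" using v w by simp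
  qed
  then show "\<exists>U K. openin mtopology U \<and> compactin mtopology K \<and> v \<in> U \<and> U \<subseteq> K"
    using v radius_pos image_compactin[OF compact_mcball_zero cont]
    by (intro exI[of _ "mball v (radius / 2)"] exI[of _ "mul v ` mcball (u 0) (radius / 2)"]) auto
qed

lemma h_in_C0: "h \<in> C0 mtopology"
  unfolding C0_def
proof (intro CollectI conjI allI impI)
  have "continuous_map mtopology (Met_TC.mtopology :: complex topology) h"
    unfolding metric_continuous_map[OF Met_TC.Metric_space_axioms]
  proof (intro conjI ballI allI impI)
    fix v and e :: real assume "v \<in> M" "0 < e"
    then show "\<exists>\<delta>>0. \<forall>x. x \<in> M \<and> d v x < \<delta> \<longrightarrow> dist (h v) (h x) < e"
      using h_lipschitz by (intro exI[of _ e]) (force simp: dist_norm)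
  qed auto
  then show "continuous_map mtopology euclidean h" by simp
next
  fix e :: real assume e: "0 < e"
  \<comment> \<open>The threshold is halved because a point with \<open>e \<le> norm (h v)\<close>
    is approximated by orbit points at which only \<open>e / 2\<close> is guaranteed.\<close>
  let ?K = "mtopology closure_of (u ` {t. e / 2 \<le> norm (h (u t))})"
  have "norm (h v) < e" if v: "v \<in> M" "v \<notin> ?K" for v
  proof (rule ccontr)
    assume "\<not> norm (h v) < e"
    have "\<exists>y\<in>u ` {t. e / 2 \<le> norm (h (u t))}. y \<in> mball v r" if r: "0 < r" for r
    proof -
      obtain s where s: "d (u s) v < min r (e / 2)"
        using dense[of v "min r (e / 2)"] v r e by auto
      then have "norm (h v - h (u s)) < e / 2"
        using h_lipschitz[of v "u s"] v by (simp add: commute)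
      then have "e / 2 \<le> norm (h (u s))"
        using norm_triangle_ineq2[of "h v" "h (u s)"] \<open>\<not> norm (h v) < e\<close> by linarith
      with s v show ?thesis by (auto simp: commute)
    qed
    with v show False by (auto simp: metric_closure_of)
  qed
  then show "\<exists>K. compactin mtopology K \<and> (\<forall>x\<in>topspace mtopology - K. norm (h x) < e)"
    using compact_large[of "e / 2"] e by (intro exI[of _ ?K]) auto
qed

section \<open>The graph of the orbit map as a lattice\<close>

definition lattice :: "('g \<times> 'a) set" where "lattice = range (\<lambda>t. (t, u t))"

lemma star_map_lattice: "star_map lattice t = u t"
  by (auto simp: star_map_def lattice_def)

lemma fst_lattice: "fst ` lattice = UNIV"
  by (force simp: lattice_def)

text \<open>Discreteness: if \<open>(s, u s)\<close> is close to \<open>(t, u t)\<close>, then the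
  weight at \<open>s - t\<close> is nonzero, and weights near 0 vanish except at 0. Cocompactness: a
  compact set of remainders in the first factor times a compact ball meets every coset.\<close>

lemma lattice_in_lattice:
  "lattice_in lattice (additive_group \<times>\<times> grp) (prod_topology euclidean mtopology)"
  unfolding lattice_in_def
proof (intro conjI)
  let ?X = "prod_topology (euclidean :: 'g topology) mtopology"
  have gA: "group (additive_group :: 'g monoid)" and gH: "group grp"
    using comm_group_additive comm_group_grp by (auto simp: comm_group_def)
  then have gP: "group ((additive_group :: 'g monoid) \<times>\<times> grp)" by (rule DirProd_group)
  show sub: "subgroup lattice (additive_group \<times>\<times> grp)"
  proof (rule group.subgroupI[OF gP])
    show "lattice \<subseteq> carrier (additive_group \<times>\<times> grp)" by (auto simp: lattice_def)
    show "lattice \<noteq> {}" by (auto simp: lattice_def)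
    show "inv\<^bsub>additive_group \<times>\<times> grp\<^esub> x \<in> lattice" if "x \<in> lattice" for x
      using that inv_DirProd[OF gA gH] by (auto simp: lattice_def inv_grp)
    show "x \<otimes>\<^bsub>additive_group \<times>\<times> grp\<^esub> y \<in> lattice" if "x \<in> lattice" "y \<in> lattice" for x y
      using that by (auto simp: lattice_def)
  qed
  obtain U where U: "open U" "0 \<in> U" "\<And>t. t \<in> U \<Longrightarrow> h (u t) \<noteq> 0 \<Longrightarrow> t = 0"
    using isolated by blast
  have "(t, u t) \<notin> ?X derived_set_of lattice" for t
  proof
    assume *: "(t, u t) \<in> ?X derived_set_of lattice"
    let ?T = "((\<lambda>x. x - t) -` U) \<times> mball (u t) (norm (h (u 0)))"
    have "open ((\<lambda>x. x - t) -` U)" using U(1) by (intro open_vimage continuous_intros)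
    then have "openin ?X ?T" by (auto simp: openin_prod_Times_iff)
    moreover have "(t, u t) \<in> ?T" using U(2) h_nz by simp
    ultimately have "\<exists>y. y \<noteq> (t, u t) \<and> y \<in> lattice \<and> y \<in> ?T"
      using *[unfolded in_derived_set_of, THEN conjunct2, THEN spec[where x = ?T]] by simp
    then obtain y where y: "y \<noteq> (t, u t)" "y \<in> lattice" "y \<in> ?T" by blast
    then obtain s where s: "y = (s, u s)" by (auto simp: lattice_def)
    with y have "s - t \<in> U" and "d (u t) (u s) < norm (h (u 0))" by auto
    then have "norm (h (u (s - t)) - h (u 0)) < norm (h (u 0))"
      using h_lipschitz[of "u (s - t)" "u 0"] d_u_diff[of s t] by (simp add: commute)
    then have "h (u (s - t)) \<noteq> 0" by auto
    then have "s = t" using U(3)[OF \<open>s - t \<in> U\<close>] by simp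
    with y s show False by simp
  qed
  then have "lattice \<inter> ?X derived_set_of lattice = {}" by (auto simp: lattice_def)
  then show "subtopology ?X lattice = discrete_topology lattice"
    by (intro subtopology_eq_discrete_topology) (auto simp: lattice_def)
  \<comment> \<open>Density and the almost period each cost \<open>e\<close>, together
    \<open>radius / 2\<close>.\<close>
  define e where "e = radius / 4"
  have e: "0 < e" using radius_pos by (simp add: e_def)
  obtain K where K: "compact K" "\<And>t. \<exists>s k. k \<in> K \<and> t = s + k \<and> d (u s) (u 0) < e"
    by (rule almost_period_obtain[OF e]) blast
  show "cocompact_in lattice (additive_group \<times>\<times> grp) ?X"
  proof (rule cocompact_inI[OF gP sub])
    show "compactin ?X (K \<times> mcball (u 0) (radius / 2))"
      using K(1) compact_mcball_zero by (simp add: compactin_Times)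
    fix x :: "'g \<times> 'a" assume "x \<in> carrier (additive_group \<times>\<times> grp)"
    then obtain g v where x: "x = (g, v)" "v \<in> M" by auto
    \<comment> \<open>First \<open>t\<close> matches the internal coordinate; the almost period
      \<open>s\<close> then corrects the coordinate \<open>g\<close> while moving the internal one
      by less than \<open>e\<close>.\<close>
    obtain t where t: "d (u t) v < e" using dense[OF x(2) e] by blast
    obtain s k where sk: "k \<in> K" "g - t = s + k" "d (u s) (u 0) < e" using K(2) by blast
    let ?w = "mul (u (- (t + s))) v"
    have "d (u 0) ?w = d (mul (u (- (t + s))) (u (t + s))) ?w" by simp
    also have "\<dots> = d (u (t + s)) v" using x(2) by (intro d_mul_cancel) auto
    also have "\<dots> \<le> d (u (s + t)) (u t) + d (u t) v"
      unfolding add.commute[of t s] using x(2) by (intro triangle) auto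
    also have "\<dots> \<le> radius / 2" using sk(3) t d_u_shift[of s t] by (simp add: e_def)
    finally have w: "?w \<in> mcball (u 0) (radius / 2)" using x(2) by simp
    have "x = (t + s, u (t + s)) \<otimes>\<^bsub>additive_group \<times>\<times> grp\<^esub> (k, ?w)"
    proof -
      have "mul (u (t + s)) ?w = v"
        using x(2) by (simp add: mul_assoc[symmetric] mul_zero del: minus_add_distrib)
      moreover have "g = t + s + k" using sk(2) by (simp add: algebra_simps)
      ultimately show ?thesis using x(1) by simp
    qed
    with sk(1) w show "\<exists>l\<in>lattice. \<exists>c\<in>K \<times> mcball (u 0) (radius / 2).
        x = l \<otimes>\<^bsub>additive_group \<times>\<times> grp\<^esub> c"
      by (intro bexI[of _ "(t + s, u (t + s))"] bexI[of _ "(k, ?w)"]) (auto simp: lattice_def)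
  qed simp
qed

lemma cut_and_project: "cut_and_project_scheme additive_group euclidean grp mtopology lattice"
  unfolding cut_and_project_scheme_def
proof (intro conjI)
  show "mtopology closure_of snd ` lattice = topspace mtopology"
  proof -
    have "\<exists>y\<in>snd ` lattice. y \<in> mball v r" if "v \<in> M" "0 < r" for v r
      using dense[OF that] that by (force simp: lattice_def commute)
    then show ?thesis by (auto simp: metric_closure_of)
  qed
  show "inj_on fst lattice" by (auto simp: lattice_def inj_on_def)
  show "lca_group (additive_group :: 'g monoid) euclidean" by (rule lca_additive[OF lc])
  show "lca_group grp mtopology" by (rule lca_groupI[OF locally_compact])
  show "lattice_in lattice (additive_group \<times>\<times> grp) (prod_topology euclidean mtopology)"
    by (rule lattice_in_lattice)
qed

end

text \<open>The abstract orbit is realised in the space of bounded functions with the supremum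
  metric, which is complete since the complex numbers are. Elements of the internal group are thus
  functions on \<open>G\<close>, which fixes their type.\<close>

theorem almost_periodic_weights_cut_and_project:
  fixes a :: "'g::{topological_ab_group_add, t2_space} \<Rightarrow> complex"
  assumes lc: "locally_compact_space (euclidean :: 'g topology)"
    and bounded: "\<And>x. norm (a x) \<le> B"
    and nz: "a 0 \<noteq> 0"
    and almost_periods: "\<And>e. 0 < e \<Longrightarrow> relatively_dense {t. \<forall>x. norm (a (x + t) - a x) \<le> e}"
    and finite_supp: "\<And>K. compact K \<Longrightarrow> finite {t \<in> K. a t \<noteq> 0}"
    and isolated: "\<exists>U. open U \<and> 0 \<in> U \<and> (\<forall>t\<in>U. a t \<noteq> 0 \<longrightarrow> t = 0)"
  shows "\<exists>(H :: ('g \<Rightarrow> complex) monoid) T \<L> h.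
      cut_and_project_scheme (additive_group :: 'g monoid) euclidean H T \<L> \<and> h \<in> C0 T \<and>
      fst ` \<L> = UNIV \<and> (\<forall>t. h (star_map \<L> t) = a t)"
proof -
  define S where "S = (Met_TC.fspace UNIV :: ('g \<Rightarrow> complex) set)"
  define d where "d = (Met_TC.fdist UNIV :: ('g \<Rightarrow> complex) \<Rightarrow> ('g \<Rightarrow> complex) \<Rightarrow> real)"
  define u where "u = (\<lambda>t x. a (x + t))"
  interpret F: Metric_space S d
    unfolding S_def d_def by (rule Met_TC.Metric_space_funspace)
  have "mcomplete_of (funspace (UNIV :: 'g set) (Met_TC.Self :: complex metric))"
    by (rule Met_TC.mcomplete_funspace) (rule complete_UNIV[folded mcomplete_iff_complete])
  then have complete: "F.mcomplete"
    by (simp add: S_def d_def mcomplete_of_def)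
  have u_S: "u t \<in> S" for t
    using bounded by (auto simp: S_def u_def Met_TC.fspace_def bounded_iff)
  have d_le: "d f g \<le> e \<longleftrightarrow> (\<forall>x. norm (f x - g x) \<le> e)" if "f \<in> S" "g \<in> S" for f g e
    using that by (simp add: S_def d_def Met_TC.funspace_mdist_le dist_norm)
  define M where "M = F.mtopology closure_of range u"
  interpret Submetric S d M
    by unfold_locales (metis M_def closure_of_subset_topspace F.topspace_mtopology)
  have M_S: "v \<in> S" if "v \<in> M" for v using that subset by auto
  have u_M: "u t \<in> M" for t
    using closure_of_subset[of "range u" F.mtopology] u_S by (auto simp: M_def)
  interpret O: almost_periodic_orbit M d u "\<lambda>v. v 0"
  proof unfold_locales
    show "u t \<in> M" for t by (rule u_M)
    show "d (u (s + x)) (u (t + x)) = d (u s) (u t)" for s x t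
    proof -
      \<comment> \<open>The distance is accessible through its upper bounds, so equality is shown by
        comparing these; translation only permutes the points of evaluation.\<close>
      have "d (u (s + x)) (u (t + x)) \<le> e \<longleftrightarrow> d (u s) (u t) \<le> e" for e
        unfolding d_le[OF u_S u_S] unfolding u_def
      proof (intro iffI allI)
        fix y assume *: "\<forall>y. norm (a (y + (s + x)) - a (y + (t + x))) \<le> e"
        show "norm (a (y + s) - a (y + t)) \<le> e"
          using *[rule_format, of "y - x"] by (simp add: algebra_simps)
      next
        fix y assume *: "\<forall>y. norm (a (y + s) - a (y + t)) \<le> e"
        show "norm (a (y + (s + x)) - a (y + (t + x))) \<le> e"
          using *[rule_format, of "y + x"] by (simp add: algebra_simps)
      qed
      then show ?thesis by (meson order_antisym order_refl)
    qed
    show "\<exists>s. d (u s) v < e" if "v \<in> M" "0 < e" for v e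
      using that by (auto simp: M_def F.metric_closure_of F.commute)
    show "sub.mcomplete"
      by (rule closedin_mcomplete_imp_mcomplete[OF _ complete]) (simp add: M_def)
    show "norm (v 0 - w 0) \<le> d v w" if "v \<in> M" "w \<in> M" for v w
      using d_le[of v w "d v w"] that M_S by auto
    show "u 0 0 \<noteq> 0" using nz by (simp add: u_def)
    show "relatively_dense {t. d (u t) (u 0) < e}" if e: "0 < e" for e
    proof (rule relatively_dense_mono)
      show "relatively_dense {t. \<forall>x. norm (a (x + t) - a x) \<le> e / 2}"
        using almost_periods[of "e / 2"] e by simp
      have "d (u t) (u 0) < e" if "\<forall>x. norm (a (x + t) - a x) \<le> e / 2" for t
        using d_le[OF u_S u_S, of t 0 "e / 2"] that e by (simp add: u_def)
      then show "{t. \<forall>x. norm (a (x + t) - a x) \<le> e / 2} \<subseteq> {t. d (u t) (u 0) < e}" by blast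
    qed
  qed (use lc finite_supp isolated in \<open>auto simp: u_def\<close>)
  have "star_map O.lattice t 0 = a t" for t
    unfolding O.star_map_lattice by (simp add: u_def)
  with O.cut_and_project O.h_in_C0 O.fst_lattice show ?thesis
    by (intro exI[of _ O.grp] exI[of _ sub.mtopology] exI[of _ O.lattice] exI[of _ "\<lambda>v. v 0"]) simp
qed

section \<open>From Krein's inequality to almost periodicity and the model comb\<close>

theorem theorem5p1:
  fixes m :: "'g :: {topological_ab_group_add, t2_space, second_countable_topology} measure"
    and \<mu> :: "('g \<Rightarrow> complex) \<Rightarrow> complex"
    and \<Lambda> :: "'g set"
    and a :: "'g \<Rightarrow> complex"
  assumes "locally_compact_space (euclidean :: 'g topology)"
    and "haar_measure m"
    and "radon_measure \<mu>"
    and "\<And>x. a x = point_mass \<mu> x"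
    and "is_dirac_sum \<mu> \<Lambda> a"
    and "\<exists>g\<in>Cc. \<mu> g \<noteq> 0"
    and "positive_definite m \<mu>"
    and "strongly_almost_periodic \<mu>"
    and "uniformly_discrete \<Lambda>"
  shows "(\<forall>\<epsilon>>0. relatively_dense {x \<in> \<Lambda>. Re (a x) \<ge> Re (a 0) - \<epsilon>})
    \<and> sup_almost_periodic \<mu>
    \<and> norm_almost_periodic \<mu>
    \<and> (\<exists>(H :: ('g \<Rightarrow> complex) monoid) T \<L> h.
          cut_and_project_scheme (additive_group :: 'g monoid) euclidean H T \<L>
          \<and> h \<in> C0 T \<and> is_model_comb \<mu> \<L> h)"
proof -
  have off: "a x = 0" if "x \<notin> \<Lambda>" for x
    using point_mass_off[OF assms(1,5,9) that] assms(4) by simp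
  then have comb: "discrete_comb \<mu> \<Lambda> a"
    using assms(1,5,9) by unfold_locales auto
  interpret discrete_comb \<mu> \<Lambda> a by (rule comb)
  interpret positive_definite_function a
    by unfold_locales (rule point_masses_positive_definite[OF comb assms(2,7)])
  \<comment> \<open>Since \<open>a\<close> is bounded by \<open>a0\<close>, the value 0 would make
    \<open>\<mu>\<close> vanish on all test functions.\<close>
  have "a0 \<noteq> 0"
  proof
    assume "a0 = 0"
    then have "a x = 0" for x using norm_le[of x] by simp
    then have "\<mu> g = 0" if "g \<in> Cc" for g using eval[OF that, of "{}"] by simp
    with assms(6) show False by blast
  qed
  with a_zero(2) have a0: "0 < a0" by simp
  have dense: "relatively_dense {x \<in> \<Lambda>. a0 - e \<le> Re (a x)}" if "0 < e" for e
    by (rule large_masses_relatively_dense[OF assms(8) a_zero(1) a0 that])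
  have periods: "relatively_dense {t. \<forall>x. norm (a (x + t) - a x) \<le> \<delta>}" if \<delta>: "0 < \<delta>" for \<delta>
  proof (rule relatively_dense_mono)
    \<comment> \<open>This threshold turns the bound of Krein's inequality into exactly
      \<open>\<delta>\<^sup>2\<close>.\<close>
    show "relatively_dense {x \<in> \<Lambda>. a0 - \<delta>\<^sup>2 / (2 * a0) \<le> Re (a x)}"
      using \<delta> a0 by (intro dense) simp
    have "norm (a (x + t) - a x) \<le> \<delta>" if "a0 - \<delta>\<^sup>2 / (2 * a0) \<le> Re (a t)" for t x
    proof (rule power2_le_imp_le)
      have "2 * a0 * (a0 - Re (a t)) \<le> 2 * a0 * (\<delta>\<^sup>2 / (2 * a0))"
        using that a0 by (intro mult_left_mono) auto
      with krein[of x t] a0 show "(norm (a (x + t) - a x))\<^sup>2 \<le> \<delta>\<^sup>2" by simp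
    qed (use \<delta> in simp)
    then show "{x \<in> \<Lambda>. a0 - \<delta>\<^sup>2 / (2 * a0) \<le> Re (a x)} \<subseteq> {t. \<forall>x. norm (a (x + t) - a x) \<le> \<delta>}"
      by blast
  qed
  have shift: "norm (a y - a (y - t)) \<le> \<delta>" if "\<forall>x. norm (a (x + t) - a x) \<le> \<delta>" for t y \<delta>
    using that[rule_format, of "y - t"] by simp
  have "sup_almost_periodic \<mu>"
    unfolding sup_almost_periodic_def
  proof (intro conjI allI impI)
    show "translation_bounded \<mu>" using norm_le by (rule translation_boundedI)
    show "pure_point \<mu>" using dirac_sum by (auto simp: pure_point_def)
    fix e :: real assume e: "0 < e"
    \<comment> \<open>Half of \<open>e\<close>, since the supremum only inherits a non-strict
      bound.\<close>
    then have "relatively_dense {t. \<forall>x. norm (a (x + t) - a x) \<le> e / 2}" by (intro periods) simp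
    then show "relatively_dense {t. point_sup_norm (\<lambda>g. \<mu> g - translate_measure t \<mu> g) < ennreal e}"
    proof (rule relatively_dense_mono, intro subsetI CollectI)
      fix t assume "t \<in> {t. \<forall>x. norm (a (x + t) - a x) \<le> e / 2}"
      then have "point_sup_norm (\<lambda>g. \<mu> g - translate_measure t \<mu> g) \<le> ennreal (e / 2)"
        by (intro point_sup_norm_le shift) simp
      also have "\<dots> < ennreal e" using e by (simp add: ennreal_less_iff)
      finally show "point_sup_norm (\<lambda>g. \<mu> g - translate_measure t \<mu> g) < ennreal e" .
    qed
  qed
  moreover have "norm_almost_periodic \<mu>"
    unfolding norm_almost_periodic_def
  proof (intro allI impI)
    fix K :: "'g set" and e :: real assume K: "compact K \<and> interior K \<noteq> {}" and e: "0 < e"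
    obtain C where C: "0 \<le> C" "\<forall>t \<delta>. (\<forall>y. norm (a y - a (y - t)) \<le> \<delta>) \<longrightarrow>
        norm_on K (\<lambda>g. \<mu> g - translate_measure t \<mu> g) \<le> ennreal (\<delta> * C)"
      using norm_on_diff_le[OF conjunct1[OF K]] by blast
    \<comment> \<open>Adding 1 avoids division by 0 and makes \<open>\<delta> * C < e\<close>
      strict.\<close>
    define \<delta> where "\<delta> = e / (C + 1)"
    have \<delta>: "0 < \<delta>" "\<delta> * C < e" using e C(1) by (auto simp: \<delta>_def field_simps)
    have "relatively_dense {t. \<forall>x. norm (a (x + t) - a x) \<le> \<delta>}" by (rule periods[OF \<delta>(1)])
    then show "relatively_dense {t. norm_on K (\<lambda>g. \<mu> g - translate_measure t \<mu> g) < ennreal e}"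
    proof (rule relatively_dense_mono, intro subsetI CollectI)
      fix t assume "t \<in> {t. \<forall>x. norm (a (x + t) - a x) \<le> \<delta>}"
      then have "norm_on K (\<lambda>g. \<mu> g - translate_measure t \<mu> g) \<le> ennreal (\<delta> * C)"
        using C(2) shift by simp
      also have "\<dots> < ennreal e" using \<delta>(2) e by (simp add: ennreal_lessI)
      finally show "norm_on K (\<lambda>g. \<mu> g - translate_measure t \<mu> g) < ennreal e" .
    qed
  qed
  moreover have "\<exists>(H :: ('g \<Rightarrow> complex) monoid) T \<L> h.
      cut_and_project_scheme (additive_group :: 'g monoid) euclidean H T \<L>
      \<and> h \<in> C0 T \<and> is_model_comb \<mu> \<L> h"
  proof -
    have fin: "finite {t \<in> K. a t \<noteq> 0}" if "compact K" for K
    proof -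
      obtain N where "has_density \<Lambda> K N" by (rule uniformly_discrete_has_density[OF discrete \<open>compact K\<close>])
      then have "finite {y \<in> \<Lambda>. y - 0 \<in> K}" unfolding has_density_def by blast
      then show ?thesis by (rule finite_subset[rotated]) (use off in auto)
    qed
    obtain V where V: "open V" "0 \<in> V" "\<And>y. y \<in> \<Lambda> \<Longrightarrow> y \<in> V \<Longrightarrow> y = 0"
      by (rule uniformly_discrete_isolated[OF discrete]) blast
    then have iso: "\<exists>U. open U \<and> 0 \<in> U \<and> (\<forall>t\<in>U. a t \<noteq> 0 \<longrightarrow> t = 0)"
      using off by (intro exI[of _ V]) auto
    have nz: "a 0 \<noteq> 0" using a_zero(1) a0 by simp
    obtain H :: "('g \<Rightarrow> complex) monoid" and T \<L> h
      where cps: "cut_and_project_scheme (additive_group :: 'g monoid) euclidean H T \<L>" "h \<in> C0 T"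
        "fst ` \<L> = UNIV" "\<And>t. h (star_map \<L> t) = a t"
      using almost_periodic_weights_cut_and_project[OF lc norm_le nz periods fin iso] by blast
    \<comment> \<open>The model comb sums over the whole group, as the lattice projects onto it; the
      additional points carry weight 0.\<close>
    have "((\<lambda>x. a x * g x) has_sum \<mu> g) UNIV" if g: "g \<in> Cc" for g
    proof -
      have "((\<lambda>x. a x * g x) has_sum \<mu> g) \<Lambda>" using dirac_sum g by (simp add: is_dirac_sum_def)
      then show ?thesis
        by (rule has_sum_cong_neutral[THEN iffD1, rotated -1]) (use off in auto)
    qed
    then have "is_model_comb \<mu> \<L> h" by (simp add: is_model_comb_def is_dirac_sum_def cps(3,4))
    with cps(1,2) show ?thesis by blast
  qed
  ultimately show ?thesis using dense by (simp add: a0_def[symmetric])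
qed

end
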